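(* Assume that for every $n\in\mathbb N$ there are constants $0<m_{2n}\le M_{2n}$ and $M_{2n+1}>0$ such that for all $v\in H$: i) $m_{2n}\|v\|_W^2\le\|B_1^*(t)v\|_{U_1}^2\le M_{2n}\|v\|_W^2$ for $t\in I_{2n}$; ii) $\|B_2^*(t)v\|_{U_2}^2\le M_{2n+1}\|v\|_W^2$ for $t\in I_{2n+1}$; and assume that $\inf_{n\in\mathbb N}\frac{m_{2n}}{M_{2n+1}}>0$. Assume that there is a time $\overline T>0$ such that for every $T>\overline T$ there is a constant $c=c(T)>0$, independent of the initial data, such that $$\frac12\left(\|w_0\|_V^2+\|w_1\|_H^2\right)\le c\int_0^T\|w_t(s)\|_W^2\,ds$$ for every weak solution $w$ of $w_{tt}+Aw=0$, $t>0$, $w(0)=w_0$, $w_t(0)=w_1$ with $(w_0,w_1)\in V\times H$. Assume that $T_{2n}=T^*$ for all $n\in\mathbb N$, with $T^*>\overline T$ and $T^*\ge\tau$, and $T_{2n+1}=\tilde T$ for all $n\in\mathbb N$. Assume moreover that $$\sup_{n\in\mathbb N}e^{(\xi+\frac1\xi)CM_{2n+1}\tilde T}c_n=d<1,\qquad c_n=\frac{4c(1+4C^2T_{2n}^2M_{2n}^2)}{m_{2n}+4c(1+4C^2T_{2n}^2M_{2n}^2)},$$ where $c=c(T^* )$. Then there exist two positive constants $\gamma,\mu$ such that $$E(u;t)\le\gamma e^{-\mu t}E(u;0),\qquad t>0,$$ for any solution $u$ of the delayed problem.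
   Context: $\mathbb N=\{0,1,2,\dots\}$. $H$ is a real Hilbert space; $A:\mathcal D(A)\to H$ is a positive self-adjoint operator with compact inverse; $V=\mathcal D(A^{1/2})$ with $\|v\|_V=\|A^{1/2}v\|_H$; $V'$ is the dual of $V$ with pivot space $H$. $U_1,U_2$ are real Hilbert spaces, identified with their duals; $\tau>0$ is fixed. $0=t_0<t_1<t_2<\cdots$ is a sequence, $I_n=[t_n,t_{n+1})$, $T_n=t_{n+1}-t_n$, and $T_{2n}\ge\tau$ for all $n$. $B_1(t)\in\mathcal L(U_1,H)$, $B_2(t)\in\mathcal L(U_2,H)$ satisfy, for all $n$: $B_2(t)=0$ for $t\in I_{2n}$, $B_1(t)=0$ for $t\in I_{2n+1}$, $B_1\in C^1([t_{2n},t_{2n+1}];\mathcal L(U_1,H))$ and $B_2\in C([t_{2n+1},t_{2n+2}];\mathcal L(U_2,H))$ (continuity up to the right endpoint is understood as existence of an extension from the half-open interval). $W$ is a Hilbert space in which $H$ is continuously embedded, with $C>0$ such that $\|v\|_W^2\le C\|v\|_H^2$ for all $v\in H$. Delayed problem: $$u_{tt}(t)+Au(t)+B_1(t)B_1^*(t)u_t(t)+B_2(t)B_2^*(t)u_t(t-\tau)=0,\ t>0,\qquad u(0)=u_0\in V,\ u_t(0)=u_1\in H.$$ The delay term is $0$ whenever $B_2(t)=0$, in particular on $[0,\tau)$, so no history data are needed. A solution is a mild (equivalently weak, with the equation holding in $V'$) solution $u\in C([0,\infty);V)\cap C^1([0,\infty);H)$. Energy: $$E(t)=E(u;t):=\frac12\left(\|u(t)\|_V^2+\|u_t(t)\|_H^2\right)+\frac{\xi}{2}\int_{t-\tau}^t\|B_2^*(s+\tau)u_t(s)\|_{U_2}^2\,ds,$$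 where $\xi$ is a fixed number with $0<\xi<\inf_{n}\frac{m_{2n}}{M_{2n+1}}$; the integrand is $0$ where $B_2(s+\tau)=0$, in particular for $s<0$. *)

theory Defs
  imports "HOL-Analysis.Analysis"
begin

section \<open>Unbounded self-adjoint operators\<close>

text \<open>An unbounded operator is a pair of a domain \<open>D\<close> and a function whose values outside
  \<open>D\<close> are irrelevant.\<close>

definition linear_operator_on :: "'h::real_inner set \<Rightarrow> ('h \<Rightarrow> 'h) \<Rightarrow> bool" where
  "linear_operator_on D A \<longleftrightarrow> subspace D \<and>
     (\<forall>x\<in>D. \<forall>y\<in>D. A (x + y) = A x + A y) \<and> (\<forall>a. \<forall>x\<in>D. A (a *\<^sub>R x) = a *\<^sub>R A x)"

definition operator_graph :: "'h set \<Rightarrow> ('h \<Rightarrow> 'h) \<Rightarrow> ('h \<times> 'h) set" where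
  "operator_graph D A = {(x, A x) |x. x \<in> D}"

definition adjoint_graph :: "'h::real_inner set \<Rightarrow> ('h \<Rightarrow> 'h) \<Rightarrow> ('h \<times> 'h) set" where
  "adjoint_graph D A = {(y, z). \<forall>x\<in>D. A x \<bullet> y = x \<bullet> z}"

definition self_adjoint_operator :: "'h::real_inner set \<Rightarrow> ('h \<Rightarrow> 'h) \<Rightarrow> bool" where
  "self_adjoint_operator D A \<longleftrightarrow> linear_operator_on D A \<and> closure D = UNIV \<and>
     adjoint_graph D A = operator_graph D A"

text \<open>Positivity is \<open>0 \<le> \<langle>Ax, x\<rangle>\<close>; for an invertible self-adjoint operator this is the same as
  strict positivity for \<open>x \<noteq> 0\<close>.\<close>

definition positive_self_adjoint :: "'h::real_inner set \<Rightarrow> ('h \<Rightarrow> 'h) \<Rightarrow> bool" where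
  "positive_self_adjoint D A \<longleftrightarrow> self_adjoint_operator D A \<and> (\<forall>x\<in>D. 0 \<le> A x \<bullet> x)"

definition compact_operator :: "('h::real_normed_vector \<Rightarrow> 'h) \<Rightarrow> bool" where
  "compact_operator K \<longleftrightarrow> bounded_linear K \<and> compact (closure (K ` cball 0 1))"

definition has_compact_inverse :: "'h::real_normed_vector set \<Rightarrow> ('h \<Rightarrow> 'h) \<Rightarrow> bool" where
  "has_compact_inverse D A \<longleftrightarrow>
     (\<exists>K. compact_operator K \<and> (\<forall>y. K y \<in> D \<and> A (K y) = y) \<and> (\<forall>x\<in>D. K (A x) = x))"

text \<open>\<open>is_square_root V R D A\<close> says that \<open>R\<close> with domain \<open>V\<close> is \<open>A\<^sup>1\<^sup>/\<^sup>2\<close>, i.e. the (unique)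
  positive self-adjoint operator with \<open>R\<^sup>2 = A\<close>, equality of domains included.\<close>

definition is_square_root ::
    "'h::real_inner set \<Rightarrow> ('h \<Rightarrow> 'h) \<Rightarrow> 'h set \<Rightarrow> ('h \<Rightarrow> 'h) \<Rightarrow> bool" where
  "is_square_root V R D A \<longleftrightarrow> positive_self_adjoint V R \<and>
     D = {x \<in> V. R x \<in> V} \<and> (\<forall>x\<in>D. R (R x) = A x)"


section \<open>Weak solutions and energy\<close>

abbreviation adj ::
    "('a::real_inner \<Rightarrow>\<^sub>L 'b::real_inner) \<Rightarrow> 'b \<Rightarrow> 'a" where
  "adj B \<equiv> adjoint (blinfun_apply B)"

text \<open>\<open>u \<in> C([0,\<infinity>);V) \<inter> C\<^sup>1([0,\<infinity>);H)\<close> with \<open>ut\<close> its time derivative, where \<open>V\<close> is the domain of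
  \<open>R = A\<^sup>1\<^sup>/\<^sup>2\<close>. As the norm of \<open>V\<close> is \<open>v \<mapsto> norm (R v)\<close>, continuity into \<open>V\<close> is continuity of
  \<open>R \<circ> u\<close> into \<open>H\<close>.\<close>

definition energy_class ::
    "'h::real_inner set \<Rightarrow> ('h \<Rightarrow> 'h) \<Rightarrow> (real \<Rightarrow> 'h) \<Rightarrow> (real \<Rightarrow> 'h) \<Rightarrow> bool" where
  "energy_class V R u ut \<longleftrightarrow>
     (\<forall>t\<ge>0. u t \<in> V) \<and> continuous_on {0..} (\<lambda>t. R (u t)) \<and>
     (\<forall>t\<ge>0. (u has_vector_derivative ut t) (at t within {0..})) \<and> continuous_on {0..} ut"

text \<open>The equations are equalities in \<open>V'\<close>, i.e. they hold when tested against every \<open>v \<in> V\<close>: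
  \<open>H\<close> is embedded in \<open>V'\<close> by the inner product of \<open>H\<close>, \<open>A\<close> is extended to \<open>V \<rightarrow> V'\<close> by
  \<open>\<langle>Au, v\<rangle> = R u \<bullet> R v\<close>, and \<open>\<langle>u\<^sub>t\<^sub>t, v\<rangle>\<close> is the time derivative of \<open>u\<^sub>t \<bullet> v\<close>.\<close>

definition wave_solution ::
    "'h::real_inner set \<Rightarrow> ('h \<Rightarrow> 'h) \<Rightarrow> 'h \<Rightarrow> 'h \<Rightarrow> (real \<Rightarrow> 'h) \<Rightarrow> (real \<Rightarrow> 'h) \<Rightarrow> bool" where
  "wave_solution V R w0 w1 w wt \<longleftrightarrow>
     energy_class V R w wt \<and> w 0 = w0 \<and> wt 0 = w1 \<and>
     (\<forall>v\<in>V. \<forall>t>0. \<exists>a. ((\<lambda>s. wt s \<bullet> v) has_real_derivative a) (at t) \<and>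
        a + R (w t) \<bullet> R v = 0)"

text \<open>At a switching time \<open>ts n\<close> the coefficients may jump, so that \<open>u\<^sub>t\<^sub>t\<close> need not exist there.
  Since \<open>u\<^sub>t\<close> is continuous on \<open>[0,\<infinity>)\<close>, these exceptional times carry no information.\<close>

definition delayed_solution ::
    "'h::real_inner set \<Rightarrow> ('h \<Rightarrow> 'h) \<Rightarrow> (real \<Rightarrow> 'u1::real_inner \<Rightarrow>\<^sub>L 'h) \<Rightarrow>
     (real \<Rightarrow> 'u2::real_inner \<Rightarrow>\<^sub>L 'h) \<Rightarrow> real \<Rightarrow> (nat \<Rightarrow> real) \<Rightarrow>
     'h \<Rightarrow> 'h \<Rightarrow> (real \<Rightarrow> 'h) \<Rightarrow> (real \<Rightarrow> 'h) \<Rightarrow> bool" where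
  "delayed_solution V R B1 B2 \<tau> ts u0 u1 u ut \<longleftrightarrow>
     energy_class V R u ut \<and> u 0 = u0 \<and> ut 0 = u1 \<and>
     (\<forall>v\<in>V. \<forall>t>0. t \<notin> range ts \<longrightarrow>
        (\<exists>a. ((\<lambda>s. ut s \<bullet> v) has_real_derivative a) (at t) \<and>
          a + R (u t) \<bullet> R v + B1 t (adj (B1 t) (ut t)) \<bullet> v
            + B2 t (adj (B2 t) (ut (t - \<tau>))) \<bullet> v = 0))"

text \<open>The values \<open>ut s\<close> for \<open>s < 0\<close> are arbitrary; in the intended setting they do not matter, as
  \<open>B2\<close> vanishes on \<open>[0,\<tau>)\<close>.\<close>

definition energy ::
    "('h::real_inner \<Rightarrow> 'h) \<Rightarrow> (real \<Rightarrow> 'u2::real_inner \<Rightarrow>\<^sub>L 'h) \<Rightarrow> real \<Rightarrow> real \<Rightarrow>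
     (real \<Rightarrow> 'h) \<Rightarrow> (real \<Rightarrow> 'h) \<Rightarrow> real \<Rightarrow> real" where
  "energy R B2 \<tau> \<xi> u ut t =
     1 / 2 * ((norm (R (u t)))\<^sup>2 + (norm (ut t))\<^sup>2)
     + \<xi> / 2 * integral {t - \<tau>..t} (\<lambda>s. (norm (adj (B2 (s + \<tau>)) (ut s)))\<^sup>2)"


section \<open>Regularity of the coefficients\<close>

text \<open>Regularity of \<open>B\<close> on \<open>[a,b]\<close>, when \<open>B\<close> itself is only considered on \<open>[a,b)\<close>.
  \<^const>\<open>C1_differentiable_on\<close> asks for two-sided derivatives also at the endpoints; this is
  harmless, as a function that is \<open>C\<^sup>1\<close> on \<open>[a,b]\<close> with one-sided derivatives at the
  endpoints extends to a \<open>C\<^sup>1\<close> function on the real line.\<close>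

definition C1_upto :: "real \<Rightarrow> real \<Rightarrow> (real \<Rightarrow> 'b::real_normed_vector) \<Rightarrow> bool" where
  "C1_upto a b B \<longleftrightarrow> (\<exists>F. F C1_differentiable_on {a..b} \<and> (\<forall>t\<in>{a..<b}. F t = B t))"

definition C0_upto :: "real \<Rightarrow> real \<Rightarrow> (real \<Rightarrow> 'b::real_normed_vector) \<Rightarrow> bool" where
  "C0_upto a b B \<longleftrightarrow> (\<exists>F. continuous_on {a..b} F \<and> (\<forall>t\<in>{a..<b}. F t = B t))"

end

(* The energy decreases on the damped intervals and grows at most exponentially on the delayed ones.
   On a damped interval compare the solution u with the undamped wave w having the same data at its
   left endpoint: the difference has zero data and is driven by the damping, so the energy at the left
   endpoint, which w controls by observability, is bounded by the dissipated energy. Thus a damped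
   interval contracts the energy by the factor c_n, and a whole period by d < 1.

   The undamped wave exists because the data admitting one form a closed subspace invariant under the
   inverse of the skew-adjoint generator, and its orthogonal complement, if nonzero, would contain an
   eigenvector of the compact inverse of A, for which there is an explicit solution. The energy
   identity for weak solutions is exact after smoothing by polynomials in this inverse
   which tend strongly to the identity. *)

theory Submission
  imports Defs
begin

section \<open>Hilbert spaces\<close>

text \<open>The velocity of a weak solution lies only in \<open>H\<close>, so the equation cannot be
  tested with it. This is why the generator enters only through its bounded inverse
  \<open>G\<close>: \<open>G U\<close> is differentiable even though \<open>U\<close> is merely
  continuous. The memory integral in the energy stores each delayed term \<tau> units of time before
  it acts. On a damped interval half of the damping pays for this storage, by the bound on \<xi>. On
  a delayed interval Young's inequality, weighted so that the outflow of the memory is cancelled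
  exactly, leaves the rate \<xi> + 1/\<xi>. At the start of a damped interval the memory is empty,
  because that interval is at least \<tau> long, so observability bounds the whole energy there. In
  the factor 4 of \<open>cn\<close> one 2 comes from comparing \<open>u\<close> with
  \<open>w\<close>, the other from the dissipation rate \<open>m (2*n) / 2\<close> that remains once
  the storage is paid; the summand with \<open>C\<^sup>2\<close> measures how far the damping drives
  \<open>u\<close> from \<open>w\<close>.\<close>

lemma closed_subspace_decomposition:
  fixes G :: "'a::{real_inner,complete_space} set"
  assumes G: "subspace G" "closed G"
  shows "\<exists>y\<in>G. \<forall>z\<in>G. (x - y) \<bullet> z = 0"
proof -
  define dd where "dd = (INF y\<in>G. (norm (x - y))\<^sup>2)"
  have ne: "G \<noteq> {}" using G(1) subspace_0 by blast
  have bdd: "bdd_below ((\<lambda>y. (norm (x - y))\<^sup>2) ` G)" by (intro bdd_belowI[of _ 0]) auto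
  have lower: "dd \<le> (norm (x - y))\<^sup>2" if "y \<in> G" for y
    unfolding dd_def by (rule cINF_lower[OF bdd that])
  have "\<exists>y\<in>G. (norm (x - y))\<^sup>2 < dd + e" if "e > 0" for e
    using cINF_less_iff[OF ne bdd, of "dd + e"] that unfolding dd_def by auto
  then have "\<forall>n. \<exists>y\<in>G. (norm (x - y))\<^sup>2 < dd + 1 / real (Suc n)" by simp
  then obtain Y where Y: "\<And>n. Y n \<in> G" "\<And>n. (norm (x - Y n))\<^sup>2 < dd + 1 / real (Suc n)" by metis
  \<comment> \<open>The parallelogram law makes a minimizing sequence Cauchy: the midpoint lies in
    \<open>G\<close>, so its distance to \<open>x\<close> cannot beat \<open>dd\<close>.\<close>
  have close: "(norm (Y n - Y k))\<^sup>2 \<le> 2 / real (Suc n) + 2 / real (Suc k)" for n k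
  proof -
    have "(1/2) *\<^sub>R (Y n + Y k) \<in> G" using G(1) Y(1) by (simp add: subspace_add subspace_scale)
    then have "dd \<le> (norm (x - (1/2) *\<^sub>R (Y n + Y k)))\<^sup>2" by (rule lower)
    moreover have "(norm (Y n - Y k))\<^sup>2 = 2 * (norm (x - Y n))\<^sup>2 + 2 * (norm (x - Y k))\<^sup>2
        - 4 * (norm (x - (1/2) *\<^sub>R (Y n + Y k)))\<^sup>2"
      by (simp add: power2_norm_eq_inner inner_simps inner_commute algebra_simps)
    ultimately show ?thesis using Y(2)[of n] Y(2)[of k] by simp
  qed
  have "Cauchy Y"
  proof (rule metric_CauchyI)
    fix e :: real assume e: "e > 0"
    obtain N :: nat where "4 / e\<^sup>2 < real N" using reals_Archimedean2 by blast
    then have N: "4 / real (Suc N) < e\<^sup>2" using e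
      by (simp add: field_simps) (smt (verit) zero_less_power)
    have "dist (Y n) (Y k) < e" if "n \<ge> N" "k \<ge> N" for n k
    proof -
      have "2 / real (Suc n) \<le> 2 / real (Suc N)" "2 / real (Suc k) \<le> 2 / real (Suc N)"
        using that by (auto intro!: divide_left_mono)
      then have "(norm (Y n - Y k))\<^sup>2 < e\<^sup>2" using close[of n k] N by simp
      then show ?thesis unfolding dist_norm using e power2_less_imp_less by (metis less_imp_le)
    qed
    then show "\<exists>N. \<forall>n\<ge>N. \<forall>k\<ge>N. dist (Y n) (Y k) < e" by blast
  qed
  then obtain y where lim: "Y \<longlonglongrightarrow> y" using Cauchy_convergent convergent_def by blast
  have yG: "y \<in> G" using G(2) Y(1) lim closed_sequentially by blast
  have "(\<lambda>n. (norm (x - Y n))\<^sup>2) \<longlonglongrightarrow> (norm (x - y))\<^sup>2" by (intro tendsto_intros lim)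
  moreover have "(\<lambda>n. dd + 1 / real (Suc n)) \<longlonglongrightarrow> dd + 0"
    by (intro tendsto_intros LIMSEQ_Suc[OF lim_1_over_n])
  ultimately have min: "(norm (x - y))\<^sup>2 \<le> dd"
    using LIMSEQ_le[of "\<lambda>n. (norm (x - Y n))\<^sup>2" _ "\<lambda>n. dd + 1 / real (Suc n)" "dd + 0"] Y(2)
    by (simp add: less_imp_le)
  have "(x - y) \<bullet> z = 0" if z: "z \<in> G" for z
  proof (cases "z = 0")
    case False
    \<comment> \<open>The minimizer of the distance to \<open>x\<close> along the line through
      \<open>y\<close> in direction \<open>z\<close>; a nonzero inner product would lower the
      distance below \<open>dd\<close>.\<close>
    define r where "r = ((x - y) \<bullet> z) / (z \<bullet> z)"
    have "y + r *\<^sub>R z \<in> G" using G(1) yG z by (simp add: subspace_add subspace_scale)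
    then have "dd \<le> (norm (x - y - r *\<^sub>R z))\<^sup>2"
      unfolding diff_diff_eq by (rule lower)
    with min have "(norm (x - y))\<^sup>2 \<le> (norm (x - y - r *\<^sub>R z))\<^sup>2" by linarith
    also have "\<dots> = (norm (x - y))\<^sup>2 - 2 * r * ((x - y) \<bullet> z) + r * r * (z \<bullet> z)"
      by (simp add: power2_norm_eq_inner inner_diff inner_commute algebra_simps)
    also have "\<dots> = (norm (x - y))\<^sup>2 - ((x - y) \<bullet> z)\<^sup>2 / (z \<bullet> z)"
      using False by (simp add: r_def power2_eq_square)
    finally have "((x - y) \<bullet> z)\<^sup>2 / (z \<bullet> z) \<le> 0" by simp
    then show ?thesis using False
      by (smt (verit) divide_pos_pos inner_gt_zero_iff zero_less_power2)
  qed simp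
  then show ?thesis using yG by blast
qed

lemma subspace_closure:
  fixes S :: "'a::real_normed_vector set"
  assumes S: "subspace S"
  shows "subspace (closure S)"
  unfolding subspace_def
proof (intro conjI ballI allI)
  show "0 \<in> closure S" using S subspace_0 closure_subset by blast
next
  fix x y assume "x \<in> closure S" "y \<in> closure S"
  then obtain f g where "\<And>n. f n \<in> S" "\<And>n. g n \<in> S" "f \<longlonglongrightarrow> x" "g \<longlonglongrightarrow> y"
    unfolding closure_sequential by metis
  then show "x + y \<in> closure S"
    unfolding closure_sequential using S
    by (intro exI[of _ "\<lambda>n. f n + g n"]) (auto intro: subspace_add tendsto_add)
next
  fix c x assume "x \<in> closure S"
  then obtain f where "\<And>n. f n \<in> S" "f \<longlonglongrightarrow> x"
    unfolding closure_sequential by metis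
  then show "c *\<^sub>R x \<in> closure S"
    unfolding closure_sequential using S
    by (intro exI[of _ "\<lambda>n. c *\<^sub>R f n"]) (auto intro: subspace_scale tendsto_scaleR)
qed

text \<open>The kernel of a nonzero \<open>f\<close> is a closed hyperplane, so a suitably rescaled
  vector \<open>e\<close> orthogonal to it represents \<open>f\<close>.\<close>

lemma riesz_representation:
  fixes f :: "'a::{real_inner,complete_space} \<Rightarrow> real"
  assumes f: "bounded_linear f"
  shows "\<exists>z. \<forall>x. f x = x \<bullet> z"
proof (cases "\<forall>x. f x = 0")
  case True
  then show ?thesis by (intro exI[of _ 0]) simp
next
  case False
  then obtain x0 where x0: "f x0 \<noteq> 0" by blast
  interpret bounded_linear f by (rule f)
  have "subspace {x. f x = 0}" by (auto simp: subspace_def zero add scale)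
  moreover have "closed {x. f x = 0}"
    by (intro closed_Collect_eq continuous_intros continuous_on)
  ultimately obtain y where y: "f y = 0" "\<And>z. f z = 0 \<Longrightarrow> (x0 - y) \<bullet> z = 0"
    using closed_subspace_decomposition[of "{x. f x = 0}" x0] by auto
  define e where "e = x0 - y"
  have fe: "f e \<noteq> 0" using x0 y(1) by (simp add: e_def diff)
  then have e0: "e \<noteq> 0" using zero by auto
  have "f x = x \<bullet> ((f e / (e \<bullet> e)) *\<^sub>R e)" for x
  proof -
    have "f (x - (f x / f e) *\<^sub>R e) = 0" using fe by (simp add: diff scale)
    then have "e \<bullet> (x - (f x / f e) *\<^sub>R e) = 0" using y(2) by (simp add: e_def)
    then have "x \<bullet> e = (f x / f e) * (e \<bullet> e)" by (simp add: inner_diff inner_commute)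
    then show ?thesis using fe e0 by simp
  qed
  then show ?thesis by blast
qed

text \<open>\<open>adjoint\<close> is defined by choice; Riesz representation supplies the witness
  that gives the choice its meaning.\<close>

lemma adj_inner:
  fixes B :: "'a::{real_inner,complete_space} \<Rightarrow>\<^sub>L 'b::real_inner"
  shows "B x \<bullet> y = x \<bullet> adj B y"
proof -
  have "\<exists>z. \<forall>x. B x \<bullet> y = x \<bullet> z" for y
    by (rule riesz_representation)
      (intro bounded_linear_inner_left_comp blinfun.bounded_linear_right)
  then have "\<exists>f. \<forall>x y. B x \<bullet> y = x \<bullet> f y" by metis
  then show ?thesis unfolding adjoint_def by (rule someI2_ex) simp
qed

lemma adj_eqI:
  fixes B :: "'a::{real_inner,complete_space} \<Rightarrow>\<^sub>L 'b::real_inner"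
  assumes "\<And>x. B x \<bullet> y = x \<bullet> z"
  shows "adj B y = z"
proof -
  have "(adj B y - z) \<bullet> (adj B y - z) = 0"
    using assms[of "adj B y - z"] adj_inner[of B "adj B y - z" y] by (simp add: inner_diff_right)
  then show ?thesis by simp
qed

text \<open>Serves to make \<open>adj (B t) (y t)\<close> continuous in time when both
  \<open>B\<close> and \<open>y\<close> are. The norm bound comes from testing
  \<open>B (adj B y)\<close> against \<open>y\<close>.\<close>

lemma bounded_bilinear_adj:
  "bounded_bilinear (\<lambda>(B :: 'a::{real_inner,complete_space} \<Rightarrow>\<^sub>L 'b::real_inner) y. adj B y)"
proof
  fix B B' :: "'a \<Rightarrow>\<^sub>L 'b" and y y' :: 'b and r :: real
  show "adj (B + B') y = adj B y + adj B' y"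
    by (rule adj_eqI) (simp add: blinfun.add_left inner_add adj_inner)
  show "adj B (y + y') = adj B y + adj B y'"
    by (rule adj_eqI) (simp add: inner_add adj_inner)
  show "adj (r *\<^sub>R B) y = r *\<^sub>R adj B y"
    by (rule adj_eqI) (simp add: blinfun.scaleR_left adj_inner)
  show "adj B (r *\<^sub>R y) = r *\<^sub>R adj B y"
    by (rule adj_eqI) (simp add: adj_inner)
next
  have "norm (adj B y) \<le> norm y * norm B * 1" for B :: "'a \<Rightarrow>\<^sub>L 'b" and y
  proof (cases "adj B y = 0")
    case False
    have "norm (adj B y) * norm (adj B y) = B (adj B y) \<bullet> y"
      by (simp add: adj_inner flip: power2_norm_eq_inner power2_eq_square)
    also have "\<dots> \<le> norm (B (adj B y)) * norm y" by (rule norm_cauchy_schwarz)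
    also have "\<dots> \<le> (norm B * norm (adj B y)) * norm y"
      by (intro mult_right_mono norm_blinfun) simp
    finally show ?thesis using False by (simp add: mult.commute mult.left_commute)
  qed simp
  then show "\<exists>K. \<forall>(B :: 'a \<Rightarrow>\<^sub>L 'b) y. norm (adj B y) \<le> norm B * norm y * K"
    by (metis mult.commute)
qed

lemmas adj_zero = bounded_bilinear.zero_left[OF bounded_bilinear_adj]
lemmas continuous_on_adj = bounded_bilinear.continuous_on[OF bounded_bilinear_adj]

section \<open>Evolution equations with a skew-adjoint generator\<close>

text \<open>Scalar integrals suffice for a vector derivative: since the identity holds for every
  \<open>h\<close>, it may be tested with the linearization error itself, which turns a scalar bound
  into a norm bound.\<close>

lemma weak_integral_imp_has_vector_derivative:
  fixes Y g :: "real \<Rightarrow> 'a::real_inner"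
  assumes g: "continuous_on {a..b} g"
    and Y: "\<And>h s t. a \<le> s \<Longrightarrow> s \<le> t \<Longrightarrow> t \<le> b \<Longrightarrow>
      ((\<lambda>r. g r \<bullet> h) has_integral (Y t - Y s) \<bullet> h) {s..t}"
    and t: "t \<in> {a..b}"
  shows "(Y has_vector_derivative g t) (at t within {a..b})"
  unfolding has_vector_derivative_def has_derivative_within_alt
proof (intro conjI allI impI)
  show "bounded_linear (\<lambda>h. h *\<^sub>R g t)" by (rule bounded_linear_scaleR_left)
  fix e :: real assume e: "e > 0"
  obtain \<delta> where \<delta>: "\<delta> > 0" "\<And>s. s \<in> {a..b} \<Longrightarrow> dist s t < \<delta> \<Longrightarrow> dist (g s) (g t) < e"
    using g t e unfolding continuous_on_iff by blast
  have est: "norm (Y s' - Y s - (s' - s) *\<^sub>R g t) \<le> e * (s' - s)"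
    if s: "a \<le> s" "s \<le> s'" "s' \<le> b" "\<And>r. r \<in> {s..s'} \<Longrightarrow> dist r t < \<delta>" for s s'
  proof -
    define E where "E = Y s' - Y s - (s' - s) *\<^sub>R g t"
    have "((\<lambda>r. g r \<bullet> E - g t \<bullet> E) has_integral (Y s' - Y s) \<bullet> E - (s' - s) * (g t \<bullet> E)) {s..s'}"
      using Y[OF s(1-3)] has_integral_const_real[of "g t \<bullet> E" s s'] s(2)
      by (intro has_integral_diff) simp_all
    moreover have "((\<lambda>r. e * norm E) has_integral (s' - s) * (e * norm E)) {s..s'}"
      using has_integral_const_real[of "e * norm E" s s'] s(2) by simp
    moreover have "g r \<bullet> E - g t \<bullet> E \<le> e * norm E" if "r \<in> {s..s'}" for r
    proof -
      have "g r \<bullet> E - g t \<bullet> E \<le> norm (g r - g t) * norm E"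
        using norm_cauchy_schwarz[of "g r - g t" E] by (simp add: inner_diff_left)
      also have "\<dots> \<le> e * norm E"
        using \<delta>(2)[of r] s that by (intro mult_right_mono) (auto simp: dist_norm less_imp_le)
      finally show ?thesis .
    qed
    ultimately have "(Y s' - Y s) \<bullet> E - (s' - s) * (g t \<bullet> E) \<le> (s' - s) * (e * norm E)"
      by (rule has_integral_le)
    moreover have "(Y s' - Y s) \<bullet> E - (s' - s) * (g t \<bullet> E) = norm E * norm E"
    proof -
      have "(Y s' - Y s) \<bullet> E - (s' - s) * (g t \<bullet> E) = E \<bullet> E"
        unfolding E_def by (simp only: inner_diff_left inner_scaleR_left)
      then show ?thesis by (simp add: dot_square_norm power2_eq_square)
    qed
    ultimately have "norm E * norm E \<le> (e * (s' - s)) * norm E" by (simp add: mult_ac)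
    moreover have "0 \<le> e * (s' - s)" using e s(2) by simp
    ultimately show ?thesis unfolding E_def[symmetric] by (cases "norm E = 0") auto
  qed
  have "norm (Y s - Y t - (s - t) *\<^sub>R g t) \<le> e * norm (s - t)"
    if s: "s \<in> {a..b}" "norm (s - t) < \<delta>" for s
  proof (cases "t \<le> s")
    case True
    then show ?thesis using est[of t s] s t by (auto simp: dist_norm)
  next
    case False
    have "Y s - Y t - (s - t) *\<^sub>R g t = - (Y t - Y s - (t - s) *\<^sub>R g t)"
      by (simp add: algebra_simps)
    then show ?thesis using est[of s t] s t False by (simp only: norm_minus_cancel) (auto simp: dist_norm)
  qed
  then show "\<exists>d>0. \<forall>s\<in>{a..b}. norm (s - t) < d \<longrightarrow> norm (Y s - Y t - (s - t) *\<^sub>R g t) \<le> e * norm (s - t)"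
    using \<delta>(1) by blast
qed

text \<open>\<open>G\<close> stands for the bounded inverse of an unbounded skew-adjoint generator;
  working with the inverse avoids all domain questions.\<close>

locale skew_operator =
  fixes G :: "'x::{real_inner,complete_space} \<Rightarrow> 'x"
  assumes bl: "bounded_linear G"
    and skew: "G x \<bullet> x = 0"
    and injective: "G x = 0 \<Longrightarrow> x = 0"
begin

interpretation G: bounded_linear G by (rule bl)

lemma skew_inner: "G x \<bullet> y = - (x \<bullet> G y)"
proof -
  have "G x \<bullet> y + G y \<bullet> x = 0" using skew[of "x + y"] by (simp add: G.add inner_add skew)
  then show ?thesis by (simp add: inner_commute[of "G y"])
qed

text \<open>\<open>G \<circ> G\<close> is negative, so adding a small enough multiple of it to the
  identity gives a contraction \<open>L\<close>. Its powers die out strongly because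
  \<open>G\<close> is injective, hence \<open>x - (L ^^ n) x\<close> tends to \<open>x\<close>. A
  factor \<open>G\<close> is split off since it is \<open>G U\<close>, not \<open>U\<close>, that
  can be differentiated.\<close>

lemma smoothing:
  obtains T where "\<And>n::nat. bounded_linear (T n)" "\<And>n x. T n (G x) = G (T n x)"
    "\<And>n x. norm (T n (G x)) \<le> 2 * norm x" "\<And>x. (\<lambda>n. T n (G x)) \<longlonglongrightarrow> x"
proof -
  obtain K where K: "K > 0" "\<And>x. norm (G x) \<le> norm x * K" using G.pos_bounded by blast
  \<comment> \<open>The positive operator \<open>- (G \<circ> G)\<close> has norm at most
    \<open>K\<^sup>2\<close>, so dividing by \<open>k\<close> keeps \<open>L\<close> a
    contraction.\<close>
  define k where "k = K\<^sup>2"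
  have k: "k > 0" using K(1) by (simp add: k_def)
  define L where "L x = x + (1 / k) *\<^sub>R G (G x)" for x
  have L_bl: "bounded_linear L" unfolding L_def
    by (intro bounded_linear_add bounded_linear_ident
        bounded_linear_compose[OF bounded_linear_scaleR_right] bounded_linear_compose[OF bl] bl)
  have pow_bl: "bounded_linear (L ^^ n)" for n
    by (induction n) (simp_all add: id_def o_def bounded_linear_compose[OF L_bl])
  have L_comm: "L (G x) = G (L x)" for x by (simp add: L_def G.add G.scaleR)
  have pow_comm: "(L ^^ n) (G x) = G ((L ^^ n) x)" for n x
    by (induction n) (simp_all add: L_comm)
  have decr: "(norm (L x))\<^sup>2 \<le> (norm x)\<^sup>2 - (norm (G x))\<^sup>2 / k" for x
  proof -
    have "(norm (G (G x)))\<^sup>2 \<le> (norm (G x) * K)\<^sup>2" by (intro power_mono K) simp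
    then have le: "(norm (G (G x)))\<^sup>2 / k \<le> (norm (G x))\<^sup>2"
      using k by (simp add: k_def power_mult_distrib field_simps)
    have "(norm (L x))\<^sup>2 = (norm x)\<^sup>2 + 2 / k * (G (G x) \<bullet> x) + (norm (G (G x)))\<^sup>2 / k / k"
      by (simp add: L_def power2_norm_eq_inner inner_add inner_commute algebra_simps)
    also have "G (G x) \<bullet> x = - (norm (G x))\<^sup>2"
      by (simp add: skew_inner[of "G x" x] power2_norm_eq_inner)
    also have "(norm x)\<^sup>2 + 2 / k * - (norm (G x))\<^sup>2 + (norm (G (G x)))\<^sup>2 / k / k
        \<le> (norm x)\<^sup>2 + 2 / k * - (norm (G x))\<^sup>2 + (norm (G x))\<^sup>2 / k"
      using le k by (intro add_left_mono divide_right_mono) auto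
    finally show ?thesis by simp
  qed
  have contr: "norm (L x) \<le> norm x" for x
  proof -
    have "0 \<le> (norm (G x))\<^sup>2 / k" using k by simp
    then have "(norm (L x))\<^sup>2 \<le> (norm x)\<^sup>2" using decr[of x] by linarith
    then show ?thesis by simp
  qed
  have pow_contr: "norm ((L ^^ n) x) \<le> norm x" for n x
    by (induction n) (auto intro: order_trans[OF contr])
  \<comment> \<open>On the range of \<open>G\<close> first: by \<open>decr\<close>, the squared norm
    of \<open>G ((L ^^ n) x)\<close> is at most \<open>k\<close> times the n-th drop of a convergent
    sequence. Density of the range and \<open>pow_contr\<close> then give all vectors.\<close>
  have lim_range: "(\<lambda>n. (L ^^ n) (G x)) \<longlonglongrightarrow> 0" for x
  proof -
    define b where "b n = (norm ((L ^^ n) x))\<^sup>2" for n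
    have "decseq b" unfolding b_def by (rule decseq_SucI) (simp add: power_mono contr)
    moreover have "\<forall>n. 0 \<le> b n" by (simp add: b_def)
    ultimately obtain l where l: "b \<longlonglongrightarrow> l" by (rule decseq_convergent) auto
    have "(\<lambda>n. k * (b n - b (Suc n))) \<longlonglongrightarrow> k * (l - l)"
      by (intro tendsto_intros l LIMSEQ_Suc[OF l])
    then have lim: "(\<lambda>n. k * (b n - b (Suc n))) \<longlonglongrightarrow> 0" by simp
    have upper: "(norm (G ((L ^^ n) x)))\<^sup>2 \<le> k * (b n - b (Suc n))" for n
      using decr[of "(L ^^ n) x"] k by (simp add: b_def field_simps)
    have "(\<lambda>n. (norm (G ((L ^^ n) x)))\<^sup>2) \<longlonglongrightarrow> 0"
      by (rule tendsto_sandwich[OF _ _ tendsto_const lim]) (auto simp: upper)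
    from tendsto_real_sqrt[OF this] have "(\<lambda>n. norm (G ((L ^^ n) x))) \<longlonglongrightarrow> 0" by simp
    then show ?thesis unfolding pow_comm by (rule tendsto_norm_zero_cancel)
  qed
  have dense: "x \<in> closure (range G)" for x
  proof -
    have "subspace (closure (range G))"
      by (intro subspace_closure linear_subspace_image G.linear) simp
    then obtain y where y: "y \<in> closure (range G)" "\<forall>z\<in>closure (range G). (x - y) \<bullet> z = 0"
      using closed_subspace_decomposition[of "closure (range G)" x] by auto
    \<comment> \<open>Testing with this element of the range turns orthogonality into the vanishing
      of \<open>G (x - y)\<close>.\<close>
    have "G (G (x - y)) \<in> closure (range G)" by (rule subsetD[OF closure_subset rangeI])
    then have "(x - y) \<bullet> G (G (x - y)) = 0" using y(2) by simp
    then have "G (x - y) = 0" using skew_inner[of "x - y" "G (x - y)"] by simp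
    then have "x - y = 0" by (rule injective)
    then show ?thesis using y(1) by simp
  qed
  have lim0: "(\<lambda>n. (L ^^ n) x) \<longlonglongrightarrow> 0" for x
  proof (rule LIMSEQ_I)
    fix e :: real assume e: "e > 0"
    then obtain z where z: "norm (x - G z) < e / 2"
      using dense[of x] unfolding closure_approachable
      by (metis half_gt_zero dist_norm norm_minus_commute rangeE)
    from LIMSEQ_D[OF lim_range[of z], of "e / 2"] e obtain N
      where N: "\<And>n. n \<ge> N \<Longrightarrow> norm ((L ^^ n) (G z)) < e / 2" by auto
    have "norm ((L ^^ n) x - 0) < e" if "n \<ge> N" for n
    proof -
      have "(L ^^ n) x = (L ^^ n) (x - G z) + (L ^^ n) (G z)"
        using linear_add[OF bounded_linear.linear[OF pow_bl[of n]], of "x - G z" "G z"] by simp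
      then have "norm ((L ^^ n) x) \<le> norm ((L ^^ n) (x - G z)) + norm ((L ^^ n) (G z))"
        by (metis norm_triangle_ineq)
      also have "\<dots> < e" using N[OF that] z pow_contr[of n "x - G z"] by linarith
      finally show ?thesis by simp
    qed
    then show "\<exists>N. \<forall>n\<ge>N. norm ((L ^^ n) x - 0) < e" by blast
  qed
  \<comment> \<open>The telescoping sum of \<open>L ^^ i - L ^^ Suc i\<close>, in which every
    summand contains \<open>G \<circ> G\<close>, with one factor \<open>G\<close> taken out.\<close>
  have "\<exists>T. bounded_linear T \<and> (\<forall>x. T (G x) = G (T x)) \<and> (\<forall>x. T (G x) = x - (L ^^ n) x)" for n
  proof (induction n)
    case 0
    show ?case by (intro exI[of _ "\<lambda>_. 0"]) simp
  next
    case (Suc n)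
    then obtain T where T: "bounded_linear T" "\<And>x. T (G x) = G (T x)" "\<And>x. T (G x) = x - (L ^^ n) x"
      by blast
    show ?case
    proof (intro exI[of _ "\<lambda>x. T x - (1 / k) *\<^sub>R G ((L ^^ n) x)"] conjI allI)
      show "bounded_linear (\<lambda>x. T x - (1 / k) *\<^sub>R G ((L ^^ n) x))"
        by (intro bounded_linear_sub T(1) bounded_linear_compose[OF bounded_linear_scaleR_right]
            bounded_linear_compose[OF bl] pow_bl)
    next
      fix x
      show "T (G x) - (1 / k) *\<^sub>R G ((L ^^ n) (G x)) = G (T x - (1 / k) *\<^sub>R G ((L ^^ n) x))"
        by (simp add: T(2) pow_comm G.diff G.scaleR)
      show "T (G x) - (1 / k) *\<^sub>R G ((L ^^ n) (G x)) = x - (L ^^ Suc n) x"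
        by (simp add: T(3) pow_comm) (simp add: L_def)
    qed
  qed
  then obtain T where T: "\<And>n. bounded_linear (T n)" "\<And>n x. T n (G x) = G (T n x)"
      "\<And>n x. T n (G x) = x - (L ^^ n) x" by metis
  show thesis
  proof (rule that)
    show "norm (T n (G x)) \<le> 2 * norm x" for n x
      unfolding T(3) using norm_triangle_ineq4[of x "(L ^^ n) x"] pow_contr[of n x] by linarith
    show "(\<lambda>n. T n (G x)) \<longlonglongrightarrow> x" for x
      unfolding T(3) using tendsto_diff[OF tendsto_const lim0] by simp
  qed (rule T)+
qed

text \<open>This is the integrated form of \<open>(G U)' = U + G F\<close>, tested against every \<open>h\<close>: the sort of
  \<open>'x\<close> does not imply \<^class>\<open>banach\<close>, so that vector-valued integrals are not available.\<close>

definition evolves :: "(real \<Rightarrow> 'x) \<Rightarrow> (real \<Rightarrow> 'x) \<Rightarrow> real \<Rightarrow> real \<Rightarrow> bool" where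
  "evolves F U a b \<longleftrightarrow> continuous_on {a..b} U \<and>
     (\<forall>h s t. a \<le> s \<longrightarrow> s \<le> t \<longrightarrow> t \<le> b \<longrightarrow>
       ((\<lambda>r. (U r + G (F r)) \<bullet> h) has_integral (G (U t) - G (U s)) \<bullet> h) {s..t})"

lemma evolvesI:
  assumes "continuous_on {a..b} U"
    and "\<And>h s t. a \<le> s \<Longrightarrow> s \<le> t \<Longrightarrow> t \<le> b \<Longrightarrow>
      ((\<lambda>r. (U r + G (F r)) \<bullet> h) has_integral (G (U t) - G (U s)) \<bullet> h) {s..t}"
  shows "evolves F U a b"
  using assms by (simp add: evolves_def)

lemma evolves_continuous: "evolves F U a b \<Longrightarrow> continuous_on {a..b} U"
  by (simp add: evolves_def)

lemma evolves_integral: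
  assumes "evolves F U a b" "a \<le> s" "s \<le> t" "t \<le> b"
  shows "((\<lambda>r. (U r + G (F r)) \<bullet> h) has_integral (G (U t) - G (U s)) \<bullet> h) {s..t}"
  using assms by (simp add: evolves_def)

lemma evolves_diff:
  assumes "evolves F U a b" "evolves F' U' a b"
  shows "evolves (\<lambda>t. F t - F' t) (\<lambda>t. U t - U' t) a b"
proof (rule evolvesI)
  show "continuous_on {a..b} (\<lambda>t. U t - U' t)"
    using assms by (intro continuous_on_diff evolves_continuous)
  fix h s t assume st: "a \<le> s" "s \<le> t" "t \<le> b"
  show "((\<lambda>r. (U r - U' r + G (F r - F' r)) \<bullet> h) has_integral (G (U t - U' t) - G (U s - U' s)) \<bullet> h) {s..t}"
    using has_integral_diff[OF evolves_integral[OF assms(1) st, of h] evolves_integral[OF assms(2) st, of h]]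
    by (simp add: G.diff inner_diff_left inner_add_left algebra_simps)
qed

lemma evolves_scale:
  assumes "evolves F U a b"
  shows "evolves (\<lambda>t. k *\<^sub>R F t) (\<lambda>t. k *\<^sub>R U t) a b"
proof (rule evolvesI)
  show "continuous_on {a..b} (\<lambda>t. k *\<^sub>R U t)"
    using assms by (intro continuous_intros evolves_continuous)
  fix h s t assume st: "a \<le> s" "s \<le> t" "t \<le> b"
  show "((\<lambda>r. (k *\<^sub>R U r + G (k *\<^sub>R F r)) \<bullet> h) has_integral (G (k *\<^sub>R U t) - G (k *\<^sub>R U s)) \<bullet> h) {s..t}"
    using has_integral_mult_right[OF evolves_integral[OF assms st, of h], of k]
    by (simp add: G.scaleR inner_diff_left inner_add_left algebra_simps)
qed

lemma evolves_shift:
  assumes "evolves F U (a + k) (b + k)"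
  shows "evolves (\<lambda>t. F (k + t)) (\<lambda>t. U (k + t)) a b"
proof (rule evolvesI)
  show "continuous_on {a..b} (\<lambda>t. U (k + t))"
    by (rule continuous_on_compose2[OF evolves_continuous[OF assms]]) (auto intro!: continuous_intros)
  fix h s t assume st: "a \<le> s" "s \<le> t" "t \<le> b"
  show "((\<lambda>r. (U (k + r) + G (F (k + r))) \<bullet> h) has_integral (G (U (k + t)) - G (U (k + s))) \<bullet> h) {s..t}"
    using evolves_integral[OF assms, of "s + k" "t + k" h] st
      has_integral_shift_Icc_real[of "\<lambda>r. (U r + G (F r)) \<bullet> h" k _ s t]
    by (simp add: o_def add.commute)
qed

lemma evolves_has_vector_derivative:
  assumes U: "evolves F U a b" and F: "continuous_on {a..b} F" and t: "t \<in> {a..b}"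
  shows "((\<lambda>t. G (U t)) has_vector_derivative U t + G (F t)) (at t within {a..b})"
  by (rule weak_integral_imp_has_vector_derivative[OF _ evolves_integral[OF U] t])
    (intro continuous_intros evolves_continuous[OF U] G.continuous_on F)

text \<open>Formally the derivative of \<open>(norm (U t))\<^sup>2\<close> is twice \<open>U\<close>
  times the generator applied to \<open>U\<close>, which vanishes by skewness, plus twice
  \<open>U \<bullet> F\<close>. This is a genuine computation for \<open>T n (G (U t))\<close>; the
  bound 2 in \<open>smoothing\<close>, uniform in \<open>n\<close>, lets dominated convergence carry
  it to the limit.\<close>

lemma energy_identity:
  assumes U: "evolves F U a b" and F: "continuous_on {a..b} F"
    and st: "a \<le> s" "s \<le> t" "t \<le> b"
  shows "((\<lambda>r. 2 * (U r \<bullet> F r)) has_integral (norm (U t))\<^sup>2 - (norm (U s))\<^sup>2) {s..t}"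
proof -
  obtain T where T: "\<And>n::nat. bounded_linear (T n)" "\<And>n x. T n (G x) = G (T n x)"
    "\<And>n x. norm (T n (G x)) \<le> 2 * norm x" "\<And>x. (\<lambda>n. T n (G x)) \<longlonglongrightarrow> x"
    using smoothing by blast
  have U_cont: "continuous_on {s..t} U" and F_cont: "continuous_on {s..t} F"
    using evolves_continuous[OF U] F st by (auto intro: continuous_on_subset)
  have step: "((\<lambda>r. 2 * (T n (G (U r)) \<bullet> T n (G (F r)))) has_integral
      (norm (T n (G (U t))))\<^sup>2 - (norm (T n (G (U s))))\<^sup>2) {s..t}" for n
  proof (rule fundamental_theorem_of_calculus[OF st(2)])
    fix r assume r: "r \<in> {s..t}"
    interpret Tn: bounded_linear "T n" by (rule T(1))
    define v where "v = T n (G (U r))"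
    have "((\<lambda>t. G (U t)) has_vector_derivative U r + G (F r)) (at r within {s..t})"
      by (rule has_vector_derivative_within_subset[OF evolves_has_vector_derivative[OF U F]])
        (use r st in auto)
    then have "((\<lambda>t. T n (G (U t))) has_vector_derivative T n (U r + G (F r))) (at r within {s..t})"
      by (rule bounded_linear.has_vector_derivative[OF T(1)])
    from bounded_bilinear.has_vector_derivative[OF bounded_bilinear_inner this this]
    have "((\<lambda>t. T n (G (U t)) \<bullet> T n (G (U t))) has_vector_derivative
        2 * (T n (G (U r)) \<bullet> T n (U r + G (F r)))) (at r within {s..t})"
      by (simp add: inner_commute)
    \<comment> \<open>Commuting \<open>T n\<close> with \<open>G\<close> brings this to the form of
      \<open>skew\<close> at \<open>T n (U r)\<close>.\<close>
    moreover have "T n (G (U r)) \<bullet> T n (U r) = 0" by (simp add: T(2) skew)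
    ultimately show "((\<lambda>r. (norm (T n (G (U r))))\<^sup>2) has_vector_derivative
        2 * (T n (G (U r)) \<bullet> T n (G (F r)))) (at r within {s..t})"
      by (simp add: power2_norm_eq_inner Tn.add inner_add_right)
  qed
  obtain BU where BU: "\<And>r. r \<in> {s..t} \<Longrightarrow> norm (U r) \<le> BU" "BU > 0"
    using compact_imp_bounded[OF compact_continuous_image[OF U_cont compact_Icc]]
    unfolding bounded_pos by (auto simp del: atLeastAtMost_iff)
  obtain BF where BF: "\<And>r. r \<in> {s..t} \<Longrightarrow> norm (F r) \<le> BF" "BF > 0"
    using compact_imp_bounded[OF compact_continuous_image[OF F_cont compact_Icc]]
    unfolding bounded_pos by (auto simp del: atLeastAtMost_iff)
  have bound: "norm (2 * (T n (G (U r)) \<bullet> T n (G (F r)))) \<le> 2 * ((2 * BU) * (2 * BF))"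
    if r: "r \<in> {s..t}" for n r
  proof -
    have "\<bar>T n (G (U r)) \<bullet> T n (G (F r))\<bar> \<le> norm (T n (G (U r))) * norm (T n (G (F r)))"
      by (rule Cauchy_Schwarz_ineq2)
    also have "\<dots> \<le> (2 * BU) * (2 * BF)"
      using T(3)[of n "U r"] T(3)[of n "F r"] BU(1)[OF r] BF(1)[OF r] BU(2) BF(2)
      by (intro mult_mono) (linarith | simp)+
    finally show ?thesis by (simp add: abs_mult mult_ac)
  qed
  have ptw: "(\<lambda>n. 2 * (T n (G (U r)) \<bullet> T n (G (F r)))) \<longlonglongrightarrow> 2 * (U r \<bullet> F r)" for r
    by (intro tendsto_intros T(4))
  note dom = dominated_convergence[of "\<lambda>n r. 2 * (T n (G (U r)) \<bullet> T n (G (F r)))" "{s..t}"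
      "\<lambda>_. 2 * ((2 * BU) * (2 * BF))" "\<lambda>r. 2 * (U r \<bullet> F r)"]
  have int: "(\<lambda>r. 2 * (U r \<bullet> F r)) integrable_on {s..t}"
    and lim: "(\<lambda>n. integral {s..t} (\<lambda>r. 2 * (T n (G (U r)) \<bullet> T n (G (F r)))))
      \<longlonglongrightarrow> integral {s..t} (\<lambda>r. 2 * (U r \<bullet> F r))"
    using dom step bound ptw by (blast intro: has_integral_integrable integrable_const_ivl)+
  have "(\<lambda>n. integral {s..t} (\<lambda>r. 2 * (T n (G (U r)) \<bullet> T n (G (F r)))))
      \<longlonglongrightarrow> (norm (U t))\<^sup>2 - (norm (U s))\<^sup>2"
    unfolding integral_unique[OF step] by (intro tendsto_intros T(4))
  from LIMSEQ_unique[OF lim this] integrable_integral[OF int] show ?thesis by simp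
qed

end

section \<open>Global solvability of the homogeneous equation\<close>

context skew_operator
begin

interpretation G: bounded_linear G by (rule bl)

lemma free_norm:
  assumes U: "evolves (\<lambda>_. 0) U 0 b" and t: "0 \<le> t" "t \<le> b"
  shows "norm (U t) = norm (U 0)"
proof -
  have "((\<lambda>r. 2 * (U r \<bullet> 0)) has_integral (norm (U t))\<^sup>2 - (norm (U 0))\<^sup>2) {0..t}"
    by (rule energy_identity[OF U]) (use t in auto)
  then have "(norm (U t))\<^sup>2 = (norm (U 0))\<^sup>2" by (simp add: has_integral_0_eq)
  then show ?thesis by (simp add: power2_eq_iff_nonneg)
qed

text \<open>Solvability is treated as membership of the data in a set, so that orthogonality
  arguments can replace the construction of a group of operators.\<close>

definition free_data :: "'x set" where
  "free_data = {x. \<exists>U. (\<forall>b. evolves (\<lambda>_. 0) U 0 b) \<and> U 0 = x}"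

lemma subspace_free_data: "subspace free_data"
proof -
  have zero: "0 \<in> free_data"
    by (auto simp: free_data_def evolves_def G.zero intro!: exI[of _ "\<lambda>_. 0"])
  have scale: "k *\<^sub>R x \<in> free_data" if "x \<in> free_data" for k x
  proof -
    from that obtain U where U: "\<And>b. evolves (\<lambda>_. 0) U 0 b" "U 0 = x"
      by (auto simp: free_data_def)
    then show ?thesis
      using evolves_scale[OF U(1), of k] by (auto simp: free_data_def intro!: exI[of _ "\<lambda>t. k *\<^sub>R U t"])
  qed
  have diff: "x - y \<in> free_data" if xy: "x \<in> free_data" "y \<in> free_data" for x y
  proof -
    from xy obtain U U' where U: "\<And>b. evolves (\<lambda>_. 0) U 0 b" "U 0 = x"
      "\<And>b. evolves (\<lambda>_. 0) U' 0 b" "U' 0 = y"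
      by (auto simp: free_data_def)
    then show ?thesis
      using evolves_diff[OF U(1,3)] by (auto simp: free_data_def intro!: exI[of _ "\<lambda>t. U t - U' t"])
  qed
  have "x + y \<in> free_data" if "x \<in> free_data" "y \<in> free_data" for x y
    using diff[OF that(1) scale[OF that(2), of "-1"]] by simp
  then show ?thesis using zero scale by (auto simp: subspace_def)
qed

text \<open>Testing the equation of \<open>U\<close> with \<open>G h\<close> gives the equation of
  \<open>G U\<close>, up to sign. By skewness the invariance passes to the orthogonal complement,
  where the eigenvector is sought.\<close>

lemma free_data_invariant:
  assumes "x \<in> free_data"
  shows "G x \<in> free_data"
proof -
  from assms obtain U where U: "\<And>b. evolves (\<lambda>_. 0) U 0 b" "U 0 = x"
    by (auto simp: free_data_def)
  have "evolves (\<lambda>_. 0) (\<lambda>t. G (U t)) 0 b" for b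
  proof (rule evolvesI)
    show "continuous_on {0..b} (\<lambda>t. G (U t))" by (intro G.continuous_on evolves_continuous[OF U(1)])
    fix h s t assume st: "0 \<le> s" "s \<le> t" "t \<le> b"
    show "((\<lambda>r. (G (U r) + G 0) \<bullet> h) has_integral (G (G (U t)) - G (G (U s))) \<bullet> h) {s..t}"
      using has_integral_neg[OF evolves_integral[OF U(1) st, of "G h"]]
      by (simp add: G.zero skew_inner[of _ h] inner_diff_left)
  qed
  then show ?thesis using U(2) by (auto simp: free_data_def intro!: exI[of _ "\<lambda>t. G (U t)"])
qed

text \<open>Free evolutions preserve the norm, so convergence of the data forces convergence of the
  evolutions, uniformly in time, and the limit inherits continuity and the integrated
  equation.\<close>

lemma closed_free_data: "closed free_data"
proof (unfold closed_sequential_limits, intro allI impI, elim conjE)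
  fix X x assume X: "\<forall>n. X n \<in> free_data" "X \<longlonglongrightarrow> x"
  then have "\<forall>n. \<exists>U. (\<forall>b. evolves (\<lambda>_. 0) U 0 b) \<and> U 0 = X n" by (simp add: free_data_def)
  then obtain U where U: "\<And>n b. evolves (\<lambda>_. 0) (U n) 0 b" "\<And>n. U n 0 = X n" by metis
  have dist_U: "dist (U n t) (U k t) = dist (X n) (X k)" if "0 \<le> t" for n k t
    using free_norm[OF evolves_diff[OF U(1)[of n] U(1)[of k], simplified], of t t] that U(2)
    by (simp add: dist_norm)
  have "Cauchy (\<lambda>n. U n t)" if "0 \<le> t" for t
    using LIMSEQ_imp_Cauchy[OF X(2)] by (simp add: Cauchy_def dist_U[OF that])
  then have "\<forall>t. \<exists>l. 0 \<le> t \<longrightarrow> (\<lambda>n. U n t) \<longlonglongrightarrow> l"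
    by (metis Cauchy_convergent convergent_def)
  then obtain Ul where Ul: "\<And>t. 0 \<le> t \<Longrightarrow> (\<lambda>n. U n t) \<longlonglongrightarrow> Ul t" by metis
  have dist_Ul: "dist (U n t) (Ul t) = dist (X n) x" if "0 \<le> t" for n t
  proof (rule LIMSEQ_unique)
    show "(\<lambda>k. dist (U n t) (U k t)) \<longlonglongrightarrow> dist (U n t) (Ul t)"
      by (intro tendsto_intros Ul that)
    show "(\<lambda>k. dist (U n t) (U k t)) \<longlonglongrightarrow> dist (X n) x"
      unfolding dist_U[OF that] by (intro tendsto_intros X)
  qed
  have cont: "continuous_on {0..b} Ul" for b
  proof (rule uniform_limit_theorem)
    show "uniform_limit {0..b} U Ul sequentially"
    proof (rule uniform_limitI)
      fix e :: real assume "0 < e"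
      then show "\<forall>\<^sub>F n in sequentially. \<forall>t\<in>{0..b}. dist (U n t) (Ul t) < e"
        using tendstoD[OF X(2)] by (simp add: dist_Ul)
    qed
    show "\<forall>\<^sub>F n in sequentially. continuous_on {0..b} (U n)"
      using evolves_continuous[OF U(1)] by simp
  qed simp
  obtain B where B: "\<And>n. norm (X n) \<le> B"
    using convergent_imp_Bseq[OF convergentI[OF X(2)]] unfolding Bseq_def by blast
  have "evolves (\<lambda>_. 0) Ul 0 b" for b
  proof (rule evolvesI[OF cont])
    fix h s t assume st: "0 \<le> s" "s \<le> t" "t \<le> b"
    have step: "((\<lambda>r. U n r \<bullet> h) has_integral (G (U n t) - G (U n s)) \<bullet> h) {s..t}" for n
      using evolves_integral[OF U(1) st, of n h] by (simp add: G.zero)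
    have bound: "norm (U n r \<bullet> h) \<le> B * norm h" if "r \<in> {s..t}" for n r
    proof -
      have "norm (U n r) \<le> B" using free_norm[OF U(1), of r r n] that st B[of n] by (simp add: U(2))
      then show ?thesis
        using Cauchy_Schwarz_ineq2[of "U n r" h] mult_right_mono[of "norm (U n r)" B "norm h"] by simp
    qed
    have ptw: "(\<lambda>n. U n r \<bullet> h) \<longlonglongrightarrow> Ul r \<bullet> h" if "r \<in> {s..t}" for r
      by (intro tendsto_intros Ul) (use st that in auto)
    note dom = dominated_convergence[of "\<lambda>n r. U n r \<bullet> h" "{s..t}" "\<lambda>_. B * norm h" "\<lambda>r. Ul r \<bullet> h"]
    have int: "(\<lambda>r. Ul r \<bullet> h) integrable_on {s..t}"
      and lim: "(\<lambda>n. integral {s..t} (\<lambda>r. U n r \<bullet> h)) \<longlonglongrightarrow> integral {s..t} (\<lambda>r. Ul r \<bullet> h)"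
      using dom step bound ptw by (blast intro: has_integral_integrable integrable_const_ivl)+
    have "(\<lambda>n. integral {s..t} (\<lambda>r. U n r \<bullet> h)) \<longlonglongrightarrow> (G (Ul t) - G (Ul s)) \<bullet> h"
      unfolding integral_unique[OF step] by (intro tendsto_intros G.tendsto Ul) (use st in auto)
    from LIMSEQ_unique[OF lim this] integrable_integral[OF int]
    have "((\<lambda>r. Ul r \<bullet> h) has_integral (G (Ul t) - G (Ul s)) \<bullet> h) {s..t}" by simp
    then show "((\<lambda>r. (Ul r + G 0) \<bullet> h) has_integral (G (Ul t) - G (Ul s)) \<bullet> h) {s..t}"
      by (simp add: G.zero)
  qed
  moreover have "Ul 0 = x" using LIMSEQ_unique[OF Ul[of 0]] X(2) U(2) by simp
  ultimately show "x \<in> free_data" by (auto simp: free_data_def)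
qed

text \<open>In the plane of \<open>x\<close> and \<open>G x\<close> the equation is a harmonic
  oscillator of frequency \<open>1 / sqrt l\<close>.\<close>

lemma eigenvector_free_data:
  assumes x: "G (G x) = - l *\<^sub>R x" and l: "l > 0"
  shows "x \<in> free_data"
proof -
  define w where "w = 1 / sqrt l"
  have w: "w * w * l = 1" "w > 0" using l by (simp_all add: w_def)
  \<comment> \<open>The partner of \<open>x\<close> for which \<open>w *\<^sub>R G\<close> acts on
    the pair as a quarter turn; see \<open>Gx\<close> and \<open>Gy\<close>.\<close>
  define y where "y = - w *\<^sub>R G x"
  define U where "U t = cos (w * t) *\<^sub>R x + sin (w * t) *\<^sub>R y" for t
  have Gy: "w *\<^sub>R G y = x"
    unfolding y_def G.scaleR x scaleR_scaleR using w by (simp add: mult_ac)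
  have Gx: "w *\<^sub>R G x = - y" by (simp add: y_def)
  have "evolves (\<lambda>_. 0) U 0 b" for b
  proof (rule evolvesI)
    show "continuous_on {0..b} U" unfolding U_def by (intro continuous_intros)
    fix h s t assume st: "(0::real) \<le> s" "s \<le> t" "t \<le> b"
    have "((\<lambda>r. G (U r) \<bullet> h) has_vector_derivative U r \<bullet> h) (at r within {s..t})" for r
    proof -
      have d: "((\<lambda>r. cos (w * r) * (G x \<bullet> h) + sin (w * r) * (G y \<bullet> h)) has_real_derivative
          (- sin (w * r) * w) * (G x \<bullet> h) + (cos (w * r) * w) * (G y \<bullet> h)) (at r within {s..t})"
        by (auto intro!: derivative_eq_intros)
      have "(- sin (w * r) * w) * (G x \<bullet> h) + (cos (w * r) * w) * (G y \<bullet> h)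
          = (- sin (w * r)) * ((w *\<^sub>R G x) \<bullet> h) + cos (w * r) * ((w *\<^sub>R G y) \<bullet> h)" by simp
      also have "\<dots> = U r \<bullet> h" unfolding Gx Gy by (simp add: U_def inner_add_left)
      finally show ?thesis
        using d unfolding has_real_derivative_iff_has_vector_derivative
        by (simp only: U_def G.add G.scaleR inner_add_left inner_scaleR_left)
    qed
    then have "((\<lambda>r. U r \<bullet> h) has_integral G (U t) \<bullet> h - G (U s) \<bullet> h) {s..t}"
      using st by (intro fundamental_theorem_of_calculus) auto
    then show "((\<lambda>r. (U r + G 0) \<bullet> h) has_integral (G (U t) - G (U s)) \<bullet> h) {s..t}"
      by (simp add: G.zero inner_diff_left)
  qed
  moreover have "U 0 = x" by (simp add: U_def)
  ultimately show ?thesis by (auto simp: free_data_def)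
qed

text \<open>The eigenvector is the limit of a sequence maximizing the Rayleigh quotient of the compact
  operator \<open>-G\<^sup>2\<close>.\<close>

lemma compact_eigenvector:
  assumes M: "subspace M" "closed M" "\<And>x. x \<in> M \<Longrightarrow> G x \<in> M" "M \<noteq> {0}"
    and cpt: "compact Q" "\<And>x. norm x \<le> 1 \<Longrightarrow> G (G x) \<in> Q"
  obtains x l where "x \<in> M" "x \<noteq> 0" "l > 0" "G (G x) = - l *\<^sub>R x"
proof -
  define N where "N = {x \<in> M. norm x = 1}"
  obtain K where K: "K > 0" "\<And>x. norm (G x) \<le> norm x * K" using G.pos_bounded by blast
  obtain x0 where x0: "x0 \<in> M" "x0 \<noteq> 0" using M(1,4) subspace_0 by blast
  define e0 where "e0 = (1 / norm x0) *\<^sub>R x0"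
  have e0: "e0 \<in> N" using x0 M(1) by (simp add: N_def e0_def subspace_scale)
  define l where "l = (SUP x\<in>N. (norm (G x))\<^sup>2)"
  have bdd: "bdd_above ((\<lambda>x. (norm (G x))\<^sup>2) ` N)"
  proof (intro bdd_aboveI2)
    fix x assume "x \<in> N"
    then have "norm (G x) \<le> K" using K(2)[of x] by (simp add: N_def)
    then show "(norm (G x))\<^sup>2 \<le> K\<^sup>2" by (intro power_mono) auto
  qed
  have upper: "(norm (G x))\<^sup>2 \<le> l" if "x \<in> N" for x
    unfolding l_def by (rule cSUP_upper[OF that bdd])
  have upper': "(norm (G x))\<^sup>2 \<le> l * (norm x)\<^sup>2" if "x \<in> M" for x
  proof (cases "x = 0")
    case False
    have "(1 / norm x) *\<^sub>R x \<in> N" using that False M(1) by (simp add: N_def subspace_scale)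
    from upper[OF this] show ?thesis using False by (simp add: G.scaleR power_mult_distrib power_divide field_simps)
  qed (simp add: G.zero)
  have "G e0 \<noteq> 0" using injective e0 by (force simp: N_def)
  then have l: "l > 0" using upper[OF e0] by (smt (verit) norm_eq_zero zero_less_power2)
  have "\<exists>x\<in>N. l - e < (norm (G x))\<^sup>2" if "e > 0" for e
    using less_cSUP_iff[OF _ bdd, of "l - e"] e0 that unfolding l_def by auto
  then have "\<forall>n. \<exists>x\<in>N. l - 1 / real (Suc n) < (norm (G x))\<^sup>2" by simp
  then obtain X where X: "\<And>n. X n \<in> N" "\<And>n. l - 1 / real (Suc n) < (norm (G (X n)))\<^sup>2" by metis
  have XN: "norm (X n) = 1" "X n \<in> M" for n using X(1)[of n] by (simp_all add: N_def)
  \<comment> \<open>Near-maximizers are almost eigenvectors. The decisive bound is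
    \<open>upper'\<close> at \<open>G (X n)\<close>, available because \<open>M\<close> is
    invariant.\<close>
  have near: "(norm (G (G (X n)) + l *\<^sub>R X n))\<^sup>2 \<le> l * (1 / real (Suc n))" for n
  proof -
    have "(norm (G (G (X n)) + l *\<^sub>R X n))\<^sup>2
        = (norm (G (G (X n))))\<^sup>2 + 2 * l * (G (G (X n)) \<bullet> X n) + l * l * (norm (X n))\<^sup>2"
      by (simp add: power2_norm_eq_inner inner_add inner_commute algebra_simps)
    also have "G (G (X n)) \<bullet> X n = - (norm (G (X n)))\<^sup>2"
      by (simp add: skew_inner[of "G (X n)"] power2_norm_eq_inner)
    also have "(norm (G (G (X n))))\<^sup>2 + 2 * l * - (norm (G (X n)))\<^sup>2 + l * l * (norm (X n))\<^sup>2
        \<le> l * (l - (norm (G (X n)))\<^sup>2)"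
      using upper'[OF M(3)[OF XN(2)], of n] XN(1) by (simp add: algebra_simps)
    also have "\<dots> \<le> l * (1 / real (Suc n))"
      using X(2)[of n] l by (intro mult_left_mono) (linarith | simp)+
    finally show ?thesis .
  qed
  have lim: "(\<lambda>n. G (G (X n)) + l *\<^sub>R X n) \<longlonglongrightarrow> 0"
  proof -
    have "(\<lambda>n. l * (1 / real (Suc n))) \<longlonglongrightarrow> l * 0"
      by (intro tendsto_intros LIMSEQ_Suc[OF lim_1_over_n])
    then have lim': "(\<lambda>n. l * (1 / real (Suc n))) \<longlonglongrightarrow> 0" by simp
    have "(\<lambda>n. (norm (G (G (X n)) + l *\<^sub>R X n))\<^sup>2) \<longlonglongrightarrow> 0"
      by (rule tendsto_sandwich[OF _ _ tendsto_const lim'], intro always_eventually allI zero_le_power2,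
          intro always_eventually allI near)
    from tendsto_real_sqrt[OF this] show ?thesis by (simp add: tendsto_norm_zero_iff)
  qed
  have "\<forall>n. G (G (X n)) \<in> Q" using cpt(2) XN(1) by simp
  moreover have "seq_compact Q" using cpt(1) by (simp add: compact_eq_seq_compact_metric)
  ultimately obtain q r where q: "q \<in> Q" "strict_mono r" "((\<lambda>n. G (G (X n))) \<circ> r) \<longlonglongrightarrow> q"
    using seq_compactE[of Q "\<lambda>n. G (G (X n))"] by blast
  define x where "x = (- 1 / l) *\<^sub>R q"
  \<comment> \<open>Compactness gives convergence of \<open>G (G (X n))\<close> only; the
    almost-eigenvector relation, solved for \<open>X n\<close>, makes the maximizing subsequence
    itself converge in norm.\<close>
  have "(\<lambda>n. (1 / l) *\<^sub>R ((G (G (X (r n))) + l *\<^sub>R X (r n)) - G (G (X (r n))))) \<longlonglongrightarrow> (1 / l) *\<^sub>R (0 - q)"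
    using LIMSEQ_subseq_LIMSEQ[OF lim q(2)] q(3) by (intro tendsto_intros) (simp_all add: o_def)
  then have Xr: "(\<lambda>n. X (r n)) \<longlonglongrightarrow> x" using l by (simp add: x_def)
  have "x \<in> M" using closed_sequentially[OF M(2) _ Xr] XN(2) by blast
  moreover have "norm x = 1" using LIMSEQ_unique[OF tendsto_norm[OF Xr]] XN(1) by simp
  then have "x \<noteq> 0" by auto
  moreover have "(\<lambda>n. G (G (X (r n))) + l *\<^sub>R X (r n)) \<longlonglongrightarrow> G (G x) + l *\<^sub>R x"
    by (intro tendsto_intros G.tendsto Xr)
  then have "G (G x) + l *\<^sub>R x = 0"
    using LIMSEQ_unique LIMSEQ_subseq_LIMSEQ[OF lim q(2)] by (fastforce simp: o_def)
  then have "G (G x) = - l *\<^sub>R x" by (simp add: eq_neg_iff_add_eq_0)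
  ultimately show thesis using that l by blast
qed

lemma free_data_UNIV:
  assumes cpt: "compact Q" "\<And>x. norm x \<le> 1 \<Longrightarrow> G (G x) \<in> Q"
  shows "x \<in> free_data"
proof -
  define M where "M = {x. \<forall>y\<in>free_data. x \<bullet> y = 0}"
  have "subspace M" by (auto simp: M_def subspace_def inner_add_left)
  moreover have "closed M"
  proof -
    have "M = (\<Inter>y\<in>free_data. {x. x \<bullet> y = 0})" by (auto simp: M_def)
    then show ?thesis by (auto intro!: closed_INT closed_Collect_eq continuous_intros)
  qed
  moreover have "G z \<in> M" if "z \<in> M" for z
    using that free_data_invariant by (auto simp: M_def skew_inner)
  \<comment> \<open>Such an eigenvector would lie in \<open>free_data\<close> and in its complement,
    hence be orthogonal to itself.\<close>
  moreover have "z = 0" if "z \<in> M" "G (G z) = - l *\<^sub>R z" "l > 0" for z l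
    using that eigenvector_free_data[OF that(2,3)] by (auto simp: M_def)
  ultimately have M0: "M = {0}" using compact_eigenvector[OF _ _ _ _ cpt, of M] by metis
  obtain y where y: "y \<in> free_data" "\<forall>z\<in>free_data. (x - y) \<bullet> z = 0"
    using closed_subspace_decomposition[OF subspace_free_data closed_free_data] by blast
  then have "x - y \<in> M" by (simp add: M_def)
  then show ?thesis using M0 y(1) by simp
qed

end

section \<open>The wave equation in phase space\<close>

text \<open>With \<open>S = R\<inverse>\<close>, bounded and symmetric, and \<open>p = R u\<close>, \<open>q = u\<^sub>t\<close>, the equation
  \<open>u\<^sub>t\<^sub>t + A u = f\<close> reads \<open>(S p)' = q\<close>, \<open>(S q)' = - p + S f\<close>. It is an equation for
  \<open>U = (p, q)\<close> of the form \<open>(G U)' = U + G F\<close> in which only bounded operators occur.\<close>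

locale wave_space =
  fixes V :: "'h::{real_inner,complete_space} set" and R S :: "'h \<Rightarrow> 'h"
  assumes S_bl: "bounded_linear S"
    and S_sym: "S x \<bullet> y = x \<bullet> S y"
    and S_in: "S x \<in> V"
    and R_S: "R (S x) = x"
    and S_R: "v \<in> V \<Longrightarrow> S (R v) = v"
    and SS_compact: "\<exists>Q. compact Q \<and> (\<forall>x. norm x \<le> 1 \<longrightarrow> S (S x) \<in> Q)"

text \<open>With \<open>K\<close> the inverse of \<open>A\<close>, the inverse of \<open>R\<close>
  is \<open>R \<circ> K\<close>. It is bounded because the squared norm of \<open>R (K y)\<close>
  equals \<open>K y \<bullet> y\<close>, and its square is \<open>K\<close>, which transfers
  compactness.\<close>

lemma wave_space_inverse_root:
  assumes A: "has_compact_inverse D A" and V: "is_square_root V R D A"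
  obtains S where "wave_space V R S"
proof -
  obtain K where K: "compact_operator K" "\<And>y. K y \<in> D" "\<And>y. A (K y) = y" "\<And>x. x \<in> D \<Longrightarrow> K (A x) = x"
    using A unfolding has_compact_inverse_def by blast
  have sa: "self_adjoint_operator V R" and D: "D = {x \<in> V. R x \<in> V}"
    and RR: "\<And>x. x \<in> D \<Longrightarrow> R (R x) = A x"
    using V by (auto simp: is_square_root_def positive_self_adjoint_def)
  have subV: "subspace V" and R_add: "\<And>x y. x \<in> V \<Longrightarrow> y \<in> V \<Longrightarrow> R (x + y) = R x + R y"
    and R_scale: "\<And>a x. x \<in> V \<Longrightarrow> R (a *\<^sub>R x) = a *\<^sub>R R x"
    using sa by (auto simp: self_adjoint_operator_def linear_operator_on_def)
  have R_sym: "R x \<bullet> y = x \<bullet> R y" if "x \<in> V" "y \<in> V" for x y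
  proof -
    have "(y, R y) \<in> adjoint_graph V R"
      using sa that by (auto simp: self_adjoint_operator_def operator_graph_def)
    then show ?thesis using that by (simp add: adjoint_graph_def)
  qed
  have K_bl: "bounded_linear K" using K(1) by (simp add: compact_operator_def)
  interpret K: bounded_linear K by (rule K_bl)
  have KV: "K y \<in> V" "R (K y) \<in> V" for y using K(2)[of y] D by auto
  define S where "S y = R (K y)" for y
  have S_in: "S y \<in> V" for y by (simp add: S_def KV)
  have R_S: "R (S y) = y" for y using RR[OF K(2)] K(3) by (simp add: S_def)
  have S_sym: "S x \<bullet> y = x \<bullet> S y" for x y
    using R_sym[OF S_in[of x] S_in[of y]] by (simp add: R_S)
  have R_0: "R 0 = 0" using R_scale[of 0 0] subspace_0[OF subV] by simp
  have R_inj: "x = 0" if "x \<in> V" "R x = 0" for x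
  proof -
    have "x \<in> D" using that subspace_0[OF subV] by (simp add: D)
    then show ?thesis using K(4)[of x] RR[of x] that R_0 K.zero by simp
  qed
  have S_R: "S (R v) = v" if "v \<in> V" for v
  proof -
    have v: "(-1) *\<^sub>R v \<in> V" by (rule subspace_scale[OF subV that])
    have "R (S (R v) + (-1) *\<^sub>R v) = 0"
      unfolding R_add[OF S_in v] R_scale[OF that] R_S by simp
    then have "S (R v) + (-1) *\<^sub>R v = 0"
      by (rule R_inj[OF subspace_add[OF subV S_in v]])
    then show ?thesis by simp
  qed
  have S_lin: "linear S"
    by (rule linearI) (simp_all add: S_def K.add K.scaleR R_add R_scale KV)
  obtain c where c: "c > 0" "\<And>x. norm (K x) \<le> norm x * c" using K.pos_bounded by blast
  have "norm (S y) \<le> norm y * sqrt c" for y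
  proof -
    have "(norm (S y))\<^sup>2 = R (K y) \<bullet> R (K y)" by (simp add: S_def power2_norm_eq_inner)
    also have "\<dots> = K y \<bullet> y" using R_sym[OF KV(1,2)] RR[OF K(2)] K(3) by simp
    also have "\<dots> \<le> norm (K y) * norm y" by (rule norm_cauchy_schwarz)
    also have "\<dots> \<le> (norm y * c) * norm y" by (intro mult_right_mono c) simp
    also have "\<dots> = (norm y * sqrt c)\<^sup>2" using c(1) by (simp add: power_mult_distrib power2_eq_square)
    finally show ?thesis by (rule power2_le_imp_le) (use c(1) in simp)
  qed
  then have S_bl: "bounded_linear S"
    using S_lin by (intro bounded_linear.intro) (auto simp: bounded_linear_axioms_def)
  have SS: "S (S y) = K y" for y
    using S_R[OF KV(1)] by (simp add: S_def)
  have "wave_space V R S"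
  proof (rule wave_space.intro)
    have "S (S x) \<in> closure (K ` cball 0 1)" if "norm x \<le> 1" for x
      unfolding SS using that closure_subset by fastforce
    then show "\<exists>Q. compact Q \<and> (\<forall>x. norm x \<le> 1 \<longrightarrow> S (S x) \<in> Q)"
      using K(1) unfolding compact_operator_def by blast
  qed (use S_bl S_sym S_in R_S S_R in auto)
  then show thesis by (rule that)
qed

lemma continuous_on_atLeast:
  fixes f :: "real \<Rightarrow> 'a::topological_space"
  assumes "\<And>b. continuous_on {a..b} f"
  shows "continuous_on {a..} f"
  unfolding continuous_on_eq_continuous_within
proof
  fix t assume t: "t \<in> {a..}"
  have "at t within {a..} = at t within {a..t + 1}"
    by (rule at_within_nhd[of _ "{..<t + 1}"]) auto
  then show "continuous (at t within {a..}) f"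
    using assms[of "t + 1"] t by (simp add: continuous_on_eq_continuous_within)
qed

context wave_space
begin

text \<open>The inverse of the wave generator, which sends \<open>(p, q)\<close> to
  \<open>(R q, - R p)\<close>.\<close>

definition phase :: "'h \<times> 'h \<Rightarrow> 'h \<times> 'h" where
  "phase x = (- S (snd x), S (fst x))"

sublocale S: bounded_linear S by (rule S_bl)

sublocale skew_operator phase
proof (rule skew_operator.intro)
  show "bounded_linear phase" unfolding phase_def
    by (intro bounded_linear_Pair bounded_linear_minus bounded_linear_compose[OF S_bl]
        bounded_linear_fst bounded_linear_snd)
  show "phase x \<bullet> x = 0" for x
    by (simp add: phase_def inner_prod_def S_sym[of "snd x"] inner_commute[of "snd x"])
  show "x = 0" if "phase x = 0" for x
  proof -
    have "S (snd x) = 0" "S (fst x) = 0" using that by (simp_all add: phase_def prod_eq_iff)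
    then have "snd x = R 0" "fst x = R 0" using R_S by metis+
    moreover have "R 0 = 0" using R_S[of 0] by (simp add: S.zero)
    ultimately show ?thesis by (simp add: prod_eq_iff)
  qed
qed

text \<open>The first component of the test vector enters the weak equation through
  \<open>v = S (fst h)\<close>, for which \<open>R v = fst h\<close>; the second sees only that
  \<open>ut\<close> is the derivative of \<open>u\<close>. The weak equation is asked for in the
  open interval, so that \<open>a\<close> and \<open>b\<close> may be switching times.\<close>

lemma wave_evolves:
  assumes "\<And>t. t \<in> {a..b} \<Longrightarrow> u t \<in> V" "continuous_on {a..b} (\<lambda>t. R (u t))"
    and u': "\<And>t. t \<in> {a..b} \<Longrightarrow> (u has_vector_derivative ut t) (at t within {a..b})"
    and ut: "continuous_on {a..b} ut"
    and weak: "\<And>v t. v \<in> V \<Longrightarrow> t \<in> {a<..<b} \<Longrightarrow>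
      ((\<lambda>s. ut s \<bullet> v) has_real_derivative f t \<bullet> v - R (u t) \<bullet> R v) (at t)"
  shows "evolves (\<lambda>t. (0, f t)) (\<lambda>t. (R (u t), ut t)) a b"
proof (rule evolvesI)
  show "continuous_on {a..b} (\<lambda>t. (R (u t), ut t))" by (intro continuous_on_Pair assms)
  fix h :: "'h \<times> 'h" and s t assume st: "a \<le> s" "s \<le> t" "t \<le> b"
  have "((\<lambda>r. R (u r) \<bullet> fst h - f r \<bullet> S (fst h)) has_integral
      (- (ut t \<bullet> S (fst h))) - (- (ut s \<bullet> S (fst h)))) {s..t}"
  proof (rule fundamental_theorem_of_calculus_interior[OF st(2)])
    show "continuous_on {s..t} (\<lambda>r. - (ut r \<bullet> S (fst h)))"
      using st by (intro continuous_intros continuous_on_subset[OF ut]) auto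
    fix r assume "r \<in> {s<..<t}"
    then have "((\<lambda>s. ut s \<bullet> S (fst h)) has_real_derivative
        f r \<bullet> S (fst h) - R (u r) \<bullet> R (S (fst h))) (at r)"
      using st by (intro weak S_in) auto
    from DERIV_minus[OF this] show "((\<lambda>r. - (ut r \<bullet> S (fst h))) has_vector_derivative
        R (u r) \<bullet> fst h - f r \<bullet> S (fst h)) (at r)"
      by (simp add: R_S has_real_derivative_iff_has_vector_derivative)
  qed
  moreover have "((\<lambda>r. ut r \<bullet> snd h) has_integral u t \<bullet> snd h - u s \<bullet> snd h) {s..t}"
  proof (rule fundamental_theorem_of_calculus[OF st(2)])
    fix r assume "r \<in> {s..t}"
    then have "(u has_vector_derivative ut r) (at r within {s..t})"
      using st by (intro has_vector_derivative_within_subset[OF u']) auto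
    then show "((\<lambda>r. u r \<bullet> snd h) has_vector_derivative ut r \<bullet> snd h) (at r within {s..t})"
      by (rule bounded_linear.has_vector_derivative[OF bounded_linear_inner_left])
  qed
  ultimately have *: "((\<lambda>r. (R (u r) \<bullet> fst h - f r \<bullet> S (fst h)) + ut r \<bullet> snd h) has_integral
      ((- (ut t \<bullet> S (fst h))) - (- (ut s \<bullet> S (fst h)))) + (u t \<bullet> snd h - u s \<bullet> snd h)) {s..t}"
    by (rule has_integral_add)
  have "u s \<in> V" "u t \<in> V" using assms(1) st by auto
  then have "(phase (R (u t), ut t) - phase (R (u s), ut s)) \<bullet> h
      = ((- (ut t \<bullet> S (fst h))) - (- (ut s \<bullet> S (fst h)))) + (u t \<bullet> snd h - u s \<bullet> snd h)"
    by (simp add: phase_def inner_prod_def S_R S_sym inner_diff_left)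
  moreover have "((R (u r), ut r) + phase (0, f r)) \<bullet> h
      = (R (u r) \<bullet> fst h - f r \<bullet> S (fst h)) + ut r \<bullet> snd h" for r
    by (simp add: phase_def inner_prod_def S_sym S.zero inner_diff_left)
  ultimately show "((\<lambda>r. ((R (u r), ut r) + phase (0, f r)) \<bullet> h) has_integral
      (phase (R (u t), ut t) - phase (R (u s), ut s)) \<bullet> h) {s..t}"
    using * by simp
qed

lemma free_wave_exists:
  assumes "w0 \<in> V"
  obtains w wt where "wave_solution V R w0 w1 w wt"
    "\<And>b. evolves (\<lambda>_. 0) (\<lambda>t. (R (w t), wt t)) 0 b"
proof -
  obtain Q where Q: "compact Q" "\<And>x. norm x \<le> 1 \<Longrightarrow> S (S x) \<in> Q" using SS_compact by blast
  \<comment> \<open>\<open>phase \<circ> phase\<close> acts as \<open>- (S \<circ> S)\<close> in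
    each component.\<close>
  have "compact (uminus ` Q \<times> uminus ` Q)"
    by (intro compact_Times compact_continuous_image Q(1) continuous_intros)
  moreover have "phase (phase x) \<in> uminus ` Q \<times> uminus ` Q" if "norm x \<le> 1" for x
  proof -
    have "norm (fst x) \<le> 1" "norm (snd x) \<le> 1"
      using norm_fst_le[of "fst x" "snd x"] norm_snd_le[of "snd x" "fst x"] that by auto
    then show ?thesis by (simp add: phase_def S.neg Q(2))
  qed
  ultimately have "(R w0, w1) \<in> free_data" by (rule free_data_UNIV)
  then obtain U where U: "\<And>b. evolves (\<lambda>_. 0) U 0 b" "U 0 = (R w0, w1)"
    by (auto simp: free_data_def)
  define w where "w t = S (fst (U t))" for t
  define wt where "wt t = snd (U t)" for t
  have Rw: "R (w t) = fst (U t)" for t by (simp add: w_def R_S)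
  have phase_0: "phase 0 = 0" by (simp add: phase_def S.zero zero_prod_def)
  have U': "((\<lambda>t. phase (U t)) has_vector_derivative U t) (at t within {0..})" if "0 \<le> t" for t
  proof -
    have "at t within {0..} = at t within {0..t + 1}"
      by (rule at_within_nhd[of _ "{..<t + 1}"]) auto
    then show ?thesis
      using evolves_has_vector_derivative[OF U(1) continuous_on_const, of t "t + 1"] that by (simp add: phase_0)
  qed
  have U_cont: "continuous_on {0..} U"
    by (rule continuous_on_atLeast) (rule evolves_continuous[OF U(1)])
  have "energy_class V R w wt"
    unfolding energy_class_def
  proof (intro conjI allI impI)
    show "w t \<in> V" for t by (simp add: w_def S_in)
    show "continuous_on {0..} (\<lambda>t. R (w t))" unfolding Rw by (intro continuous_intros U_cont)
    show "continuous_on {0..} wt" unfolding wt_def by (intro continuous_intros U_cont)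
    fix t :: real assume "0 \<le> t"
    from bounded_linear.has_vector_derivative[OF bounded_linear_snd U'[OF this]]
    show "(w has_vector_derivative wt t) (at t within {0..})"
      by (simp add: phase_def w_def[abs_def] wt_def)
  qed
  moreover have "\<exists>a. ((\<lambda>s. wt s \<bullet> v) has_real_derivative a) (at t) \<and> a + R (w t) \<bullet> R v = 0"
    if v: "v \<in> V" and t: "t > 0" for v t
  proof (intro exI conjI)
    have "at t within {0..} = at t" using t by (intro at_within_interior) (auto simp: interior_Ici)
    then have "((\<lambda>t. phase (U t)) has_vector_derivative U t) (at t)" using U'[of t] t by simp
    from bounded_linear.has_vector_derivative[OF bounded_linear_minus[OF
        bounded_linear_inner_left_comp[OF bounded_linear_fst, of "R v"]] this]
    have "((\<lambda>t. S (wt t) \<bullet> R v) has_vector_derivative - (fst (U t) \<bullet> R v)) (at t)"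
      by (simp add: phase_def wt_def)
    then show "((\<lambda>s. wt s \<bullet> v) has_real_derivative - (R (w t) \<bullet> R v)) (at t)"
      by (simp add: S_sym S_R[OF v] Rw has_real_derivative_iff_has_vector_derivative)
  qed simp
  moreover have "w 0 = w0" "wt 0 = w1" using U(2) by (simp_all add: w_def wt_def S_R assms)
  ultimately have "wave_solution V R w0 w1 w wt" by (simp add: wave_solution_def)
  moreover have "evolves (\<lambda>_. 0) (\<lambda>t. (R (w t), wt t)) 0 b" for b
    using U(1)[of b] by (simp add: Rw wt_def)
  ultimately show thesis by (rule that)
qed

end

section \<open>Integral inequalities\<close>

text \<open>Coefficient bounds hold on half-open intervals, as the coefficients may jump at the
  right end; one point does not affect the integral.\<close>

lemma integral_le_Ico:
  fixes f g :: "real \<Rightarrow> real"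
  assumes f: "f integrable_on {a..b}" and g: "g integrable_on {a..b}"
    and le: "\<And>x. x \<in> {a..<b} \<Longrightarrow> f x \<le> g x"
  shows "integral {a..b} f \<le> integral {a..b} g"
proof -
  have "integral {a..b} g = integral {a..b} (g(b := f b))"
    by (rule integral_spike[of "{b}"]) auto
  moreover have "g(b := f b) integrable_on {a..b}"
    by (rule integrable_spike[OF g, of "{b}"]) auto
  ultimately show ?thesis using le by (auto intro!: integral_le f)
qed

text \<open>Cauchy-Schwarz against the constant 1, read off from the integral of the square of
  \<open>(b - a) * f x - I\<close>.\<close>

lemma integral_square_le:
  fixes f :: "real \<Rightarrow> real"
  assumes f: "continuous_on {a..b} f" and ab: "a \<le> b"
  shows "(integral {a..b} f)\<^sup>2 \<le> (b - a) * integral {a..b} (\<lambda>x. (f x)\<^sup>2)"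
proof (cases "a = b")
  case False
  define I where "I = integral {a..b} f"
  define J where "J = integral {a..b} (\<lambda>x. (f x)\<^sup>2)"
  have int: "(f has_integral I) {a..b}" "((\<lambda>x. (f x)\<^sup>2) has_integral J) {a..b}"
    unfolding I_def J_def
    by (intro integrable_integral integrable_continuous_real continuous_intros f)+
  have "((\<lambda>x. (b - a)\<^sup>2 * (f x)\<^sup>2 - 2 * (b - a) * I * f x + I\<^sup>2) has_integral
      (b - a)\<^sup>2 * J - 2 * (b - a) * I * I + (b - a) * I\<^sup>2) {a..b}"
    using has_integral_const_real[of "I\<^sup>2" a b] ab
    by (intro has_integral_add has_integral_diff has_integral_mult_right int) simp
  then have "0 \<le> (b - a)\<^sup>2 * J - 2 * (b - a) * I * I + (b - a) * I\<^sup>2"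
  proof (rule has_integral_nonneg)
    fix x
    have "(b - a)\<^sup>2 * (f x)\<^sup>2 - 2 * (b - a) * I * f x + I\<^sup>2 = ((b - a) * f x - I)\<^sup>2"
      by (simp add: power2_eq_square algebra_simps)
    then show "0 \<le> (b - a)\<^sup>2 * (f x)\<^sup>2 - 2 * (b - a) * I * f x + I\<^sup>2" by simp
  qed
  also have "\<dots> = (b - a) * ((b - a) * J - I\<^sup>2)" by (simp add: power2_eq_square algebra_simps)
  finally show ?thesis using ab False unfolding I_def J_def by (simp add: zero_le_mult_iff)
qed simp

text \<open>The integrand is a continuous minorant \<open>y\<close> of \<open>E\<close>, so no
  regularity of \<open>E\<close> is asked for: only the right-hand side \<open>Y\<close> of the
  integral inequality is differentiated.\<close>

lemma gronwall_integral:
  fixes E y :: "real \<Rightarrow> real"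
  assumes y: "continuous_on {a..b} y" and k: "0 \<le> k"
    and yE: "\<And>t. t \<in> {a..b} \<Longrightarrow> y t \<le> E t"
    and E: "\<And>t. t \<in> {a..b} \<Longrightarrow> E t \<le> E a + k * integral {a..t} y"
    and t: "t \<in> {a..b}"
  shows "E t \<le> exp (k * (t - a)) * E a"
proof -
  define Y where "Y s = E a + k * integral {a..s} y" for s
  define g where "g s = exp (- k * (s - a)) * Y s" for s
  have Y': "(Y has_real_derivative k * y s) (at s within {a..b})" if "s \<in> {a..b}" for s
    unfolding Y_def using integral_has_real_derivative[OF y that] by (auto intro!: derivative_eq_intros)
  have g': "(g has_real_derivative exp (- k * (s - a)) * (k * (y s - Y s))) (at s within {a..b})"
    if "s \<in> {a..b}" for s
    unfolding g_def by (auto intro!: derivative_eq_intros Y' that simp: algebra_simps)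
  have "g t \<le> g a"
  proof (rule DERIV_nonpos_imp_decreasing_open[where f = g])
    show "a \<le> t" using t by simp
    have "continuous_on {a..b} g"
      using g' by (meson continuous_on_eq_continuous_within DERIV_continuous)
    then show "continuous_on {a..t} g" using t by (auto intro: continuous_on_subset)
    fix s assume s: "a < s" "s < t"
    have "at s within {a..b} = at s" using s t by (intro at_within_interior) auto
    then have "(g has_real_derivative exp (- k * (s - a)) * (k * (y s - Y s))) (at s)"
      using g'[of s] s t by simp
    moreover have "y s \<le> Y s" using yE[of s] E[of s] s t by (simp add: Y_def)
    then have "exp (- k * (s - a)) * (k * (y s - Y s)) \<le> 0"
      using k by (auto simp: mult_le_0_iff)
    ultimately show "\<exists>d. (g has_real_derivative d) (at s) \<and> d \<le> 0" by blast
  qed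
  then have "exp (- k * (t - a)) * Y t \<le> E a" by (simp add: g_def Y_def)
  then have "exp (k * (t - a)) * (exp (- k * (t - a)) * Y t) \<le> exp (k * (t - a)) * E a"
    by (intro mult_left_mono) auto
  moreover have "exp (k * (t - a)) * (exp (- k * (t - a)) * Y t) = Y t"
    by (simp add: mult.assoc[symmetric] exp_add[symmetric])
  ultimately have "Y t \<le> exp (k * (t - a)) * E a" by (simp only:)
  then show ?thesis using E[OF t] unfolding Y_def by linarith
qed

section \<open>Observability of the damped equation\<close>

text \<open>\<open>Z = U - W\<close> starts at zero and is forced by the damping of
  \<open>U\<close>, so its norm is bounded by the integral of \<open>norm (j (snd (U t)))\<close>.
  Splitting \<open>W = U - Z\<close> costs the outer factor 2;
  \<open>4 * C\<^sup>2 * T\<^sup>2 * M\<^sup>2\<close> collects the bound on \<open>Z\<close>, with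
  one \<open>T\<close> from Cauchy-Schwarz and one from integrating the resulting constant.\<close>

lemma (in wave_space) observability_estimate:
  fixes B :: "real \<Rightarrow> 'u::{real_inner,complete_space} \<Rightarrow>\<^sub>L 'h" and j :: "'h \<Rightarrow> 'w::real_inner"
  assumes T: "0 \<le> T"
    and B: "continuous_on {0..T} B"
    and U: "evolves (\<lambda>t. (0, - B t (adj (B t) (snd (U t))))) U 0 T"
    and W: "evolves (\<lambda>_. 0) W 0 T" and UW: "W 0 = U 0"
    and j: "bounded_linear j" and C: "0 \<le> C" "\<And>v. (norm (j v))\<^sup>2 \<le> C * (norm v)\<^sup>2"
    and M: "0 \<le> M" "\<And>t v. t \<in> {0..<T} \<Longrightarrow> (norm (adj (B t) v))\<^sup>2 \<le> M * (norm (j v))\<^sup>2"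
  shows "integral {0..T} (\<lambda>t. (norm (j (snd (W t))))\<^sup>2)
    \<le> 2 * (1 + 4 * C\<^sup>2 * T\<^sup>2 * M\<^sup>2) * integral {0..T} (\<lambda>t. (norm (j (snd (U t))))\<^sup>2)"
proof -
  interpret j: bounded_linear j by (rule j)
  define F where "F t = ((0::'h), - B t (adj (B t) (snd (U t))))" for t
  define Z where "Z t = U t - W t" for t
  define f where "f t = norm (j (snd (U t)))" for t
  have U_cont: "continuous_on {0..T} U" by (rule evolves_continuous[OF U])
  have W_cont: "continuous_on {0..T} W" by (rule evolves_continuous[OF W])
  have Z_cont: "continuous_on {0..T} Z" unfolding Z_def by (intro continuous_intros U_cont W_cont)
  have f_cont: "continuous_on {0..T} f" unfolding f_def by (intro continuous_intros j.continuous_on U_cont)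
  have F_cont: "continuous_on {0..T} F" unfolding F_def
    by (intro continuous_intros bounded_bilinear.continuous_on[OF bounded_bilinear_blinfun_apply]
        continuous_on_adj U_cont B)
  have Z: "evolves F Z 0 T"
    using evolves_diff[OF U W] unfolding F_def Z_def by simp
  have jC: "norm (j v) \<le> sqrt C * norm v" for v
    using real_sqrt_le_mono[OF C(2)[of v]] by (simp add: real_sqrt_mult)
  have BM: "norm (adj (B t) v) \<le> sqrt M * norm (j v)" if "t \<in> {0..<T}" for t v
    using real_sqrt_le_mono[OF M(2)[OF that, of v]] by (simp add: real_sqrt_mult)
  \<comment> \<open>At the largest value \<open>N\<close> of the norm, the energy identity bounds
    \<open>N\<^sup>2\<close> by \<open>N\<close> times an integral of the force, so that one factor
    \<open>N\<close> cancels.\<close>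
  obtain t0 where t0: "t0 \<in> {0..T}" "\<And>t. t \<in> {0..T} \<Longrightarrow> norm (Z t) \<le> norm (Z t0)"
    using continuous_attains_sup[of "{0..T}" "\<lambda>t. norm (Z t)"] T continuous_on_norm[OF Z_cont]
    by auto
  define N where "N = norm (Z t0)"
  define J where "J = integral {0..T} f"
  define I where "I = integral {0..T} (\<lambda>t. (f t)\<^sup>2)"
  have J: "J\<^sup>2 \<le> T * I" using integral_square_le[OF f_cont T] by (simp add: J_def I_def)
  have N0: "0 \<le> N" by (simp add: N_def)
  have "N\<^sup>2 = integral {0..t0} (\<lambda>t. 2 * (Z t \<bullet> F t))"
    using integral_unique[OF energy_identity[OF Z F_cont, of 0 t0]] t0(1) UW by (simp add: N_def Z_def)
  also have "\<dots> \<le> integral {0..t0} (\<lambda>t. 2 * M * sqrt C * N * f t)"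
  proof (rule integral_le_Ico)
    show "(\<lambda>t. 2 * (Z t \<bullet> F t)) integrable_on {0..t0}"
      using energy_identity[OF Z F_cont, of 0 t0] t0(1) by (auto simp: integrable_on_def)
    show "(\<lambda>t. 2 * M * sqrt C * N * f t) integrable_on {0..t0}"
      using t0(1) by (intro integrable_continuous_real continuous_intros continuous_on_subset[OF f_cont]) auto
    fix t assume t: "t \<in> {0..<t0}"
    then have tT: "t \<in> {0..<T}" "t \<in> {0..T}" using t0(1) by auto
    \<comment> \<open>Moving \<open>B t\<close> onto \<open>Z\<close> makes the bound by
      \<open>M\<close> apply to both velocities, so that only their images under \<open>j\<close>
      remain.\<close>
    have "Z t \<bullet> F t = - (adj (B t) (snd (U t)) \<bullet> adj (B t) (snd (Z t)))"
      by (simp add: F_def inner_prod_def adj_inner[symmetric] inner_commute[of "snd (Z t)"])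
    also have "\<dots> \<le> norm (adj (B t) (snd (U t))) * norm (adj (B t) (snd (Z t)))"
      using Cauchy_Schwarz_ineq2[of "adj (B t) (snd (U t))" "adj (B t) (snd (Z t))"] by linarith
    also have "\<dots> \<le> (sqrt M * f t) * (sqrt M * norm (j (snd (Z t))))"
      unfolding f_def using M(1) by (intro mult_mono BM tT) auto
    also have "\<dots> = M * f t * norm (j (snd (Z t)))"
      using M(1) by (simp add: mult_ac)
    also have "\<dots> \<le> M * f t * (sqrt C * N)"
    proof (intro mult_left_mono)
      have "norm (snd (Z t)) \<le> N"
        using norm_snd_le[of "snd (Z t)" "fst (Z t)"] t0(2)[OF tT(2)] by (simp add: N_def)
      then show "norm (j (snd (Z t))) \<le> sqrt C * N"
        using jC[of "snd (Z t)"] C(1) by (meson mult_left_mono order_trans real_sqrt_ge_zero)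
    qed (use M(1) in \<open>simp add: f_def\<close>)
    finally show "2 * (Z t \<bullet> F t) \<le> 2 * M * sqrt C * N * f t" by (simp add: mult_ac)
  qed
  also have "\<dots> = 2 * M * sqrt C * N * integral {0..t0} f" by simp
  also have "\<dots> \<le> 2 * M * sqrt C * N * J"
    unfolding J_def using t0(1) M(1) N0 C(1)
    by (intro mult_left_mono integral_subset_le integrable_continuous_real
        continuous_on_subset[OF f_cont]) (auto simp: f_def)
  finally have "N * N \<le> (2 * M * sqrt C * J) * N" by (simp add: power2_eq_square mult_ac)
  moreover have "0 \<le> 2 * M * sqrt C * J"
    unfolding J_def using M(1) C(1)
    by (intro mult_nonneg_nonneg integral_nonneg integrable_continuous_real f_cont) (auto simp: f_def)
  ultimately have "N \<le> 2 * M * sqrt C * J" using N0 by (cases "N = 0") auto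
  then have "N\<^sup>2 \<le> (2 * M * sqrt C * J)\<^sup>2" using N0 by (rule power_mono)
  also have "\<dots> = 4 * M\<^sup>2 * C * J\<^sup>2" using C(1) by (simp add: power_mult_distrib)
  also have "\<dots> \<le> 4 * M\<^sup>2 * C * (T * I)" using C(1) by (intro mult_left_mono J) auto
  finally have N2: "N\<^sup>2 \<le> 4 * M\<^sup>2 * C * (T * I)" .
  have "integral {0..T} (\<lambda>t. (norm (j (snd (W t))))\<^sup>2) \<le> integral {0..T} (\<lambda>t. 2 * (f t)\<^sup>2 + 2 * C * N\<^sup>2)"
  proof (rule integral_le)
    show "(\<lambda>t. (norm (j (snd (W t))))\<^sup>2) integrable_on {0..T}"
      by (intro integrable_continuous_real continuous_intros j.continuous_on W_cont)
    show "(\<lambda>t. 2 * (f t)\<^sup>2 + 2 * C * N\<^sup>2) integrable_on {0..T}"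
      by (intro integrable_continuous_real continuous_intros f_cont)
    fix t assume t: "t \<in> {0..T}"
    have "(norm (j (snd (W t))))\<^sup>2 = (norm (j (snd (U t)) - j (snd (Z t))))\<^sup>2"
      by (simp add: Z_def j.diff)
    also have "\<dots> \<le> 2 * (f t)\<^sup>2 + 2 * (norm (j (snd (Z t))))\<^sup>2"
    proof -
      have "0 \<le> (norm (j (snd (U t)) + j (snd (Z t))))\<^sup>2" by simp
      then show ?thesis unfolding f_def
        by (simp add: power2_norm_eq_inner inner_add inner_diff inner_commute)
    qed
    also have "(norm (j (snd (Z t))))\<^sup>2 \<le> C * N\<^sup>2"
    proof -
      have "norm (snd (Z t)) \<le> N"
        using norm_snd_le[of "snd (Z t)" "fst (Z t)"] t0(2)[OF t] by (simp add: N_def)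
      then have "C * (norm (snd (Z t)))\<^sup>2 \<le> C * N\<^sup>2" using C(1) by (intro mult_left_mono power_mono) auto
      then show ?thesis using C(2)[of "snd (Z t)"] by linarith
    qed
    finally show "(norm (j (snd (W t))))\<^sup>2 \<le> 2 * (f t)\<^sup>2 + 2 * C * N\<^sup>2" by simp
  qed
  also have "\<dots> = 2 * I + 2 * C * N\<^sup>2 * T"
  proof -
    have "integral {0..T} (\<lambda>t. 2 * (f t)\<^sup>2 + 2 * C * N\<^sup>2)
        = integral {0..T} (\<lambda>t. 2 * (f t)\<^sup>2) + integral {0..T} (\<lambda>_. 2 * C * N\<^sup>2)"
      by (intro integral_add integrable_continuous_real continuous_intros f_cont)
    then show ?thesis using T by (simp add: I_def mult_ac)
  qed
  also have "\<dots> \<le> 2 * I + 2 * C * (4 * M\<^sup>2 * C * (T * I)) * T"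
    using T C(1) by (intro add_left_mono mult_right_mono mult_left_mono N2) auto
  also have "\<dots> = 2 * (1 + 4 * C\<^sup>2 * T\<^sup>2 * M\<^sup>2) * I" by (simp add: power2_eq_square algebra_simps)
  finally show ?thesis by (simp add: I_def f_def)
qed

section \<open>The delayed problem\<close>

text \<open>One solution is fixed throughout. \<open>xi(2)\<close> is the working form of the
  infimum condition: the damping dominates \<xi> times the bound for the delayed feedback.\<close>

locale delayed_wave = wave_space V R S
  for V :: "'h::{real_inner,complete_space} set" and R S :: "'h \<Rightarrow> 'h" +
  fixes j :: "'h \<Rightarrow> 'w::real_inner"
    and B1 :: "real \<Rightarrow> 'u1::{real_inner,complete_space} \<Rightarrow>\<^sub>L 'h"
    and B2 :: "real \<Rightarrow> 'u2::{real_inner,complete_space} \<Rightarrow>\<^sub>L 'h"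
    and ts :: "nat \<Rightarrow> real" and m M :: "nat \<Rightarrow> real" and \<tau> \<xi> C :: real
    and u ut :: "real \<Rightarrow> 'h"
  assumes tau: "\<tau> > 0"
    and ts: "ts 0 = 0" "strict_mono ts" "\<And>n. ts (2*n+1) - ts (2*n) \<ge> \<tau>"
    and B2_zero: "\<And>n t. t \<in> {ts (2*n)..<ts (2*n+1)} \<Longrightarrow> B2 t = 0"
    and B1_zero: "\<And>n t. t \<in> {ts (2*n+1)..<ts (2*n+2)} \<Longrightarrow> B1 t = 0"
    and B1_C0: "\<And>n. C0_upto (ts (2*n)) (ts (2*n+1)) B1"
    and B2_C0: "\<And>n. C0_upto (ts (2*n+1)) (ts (2*n+2)) B2"
    and j: "bounded_linear j" and C: "C > 0" "\<And>v. (norm (j v))\<^sup>2 \<le> C * (norm v)\<^sup>2"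
    and M_pos: "\<And>n. 0 < M n"
    and B1_bounds: "\<And>n t v. t \<in> {ts (2*n)..<ts (2*n+1)} \<Longrightarrow>
        m (2*n) * (norm (j v))\<^sup>2 \<le> (norm (adj (B1 t) v))\<^sup>2 \<and>
        (norm (adj (B1 t) v))\<^sup>2 \<le> M (2*n) * (norm (j v))\<^sup>2"
    and B2_bound: "\<And>n t v. t \<in> {ts (2*n+1)..<ts (2*n+2)} \<Longrightarrow>
        (norm (adj (B2 t) v))\<^sup>2 \<le> M (2*n+1) * (norm (j v))\<^sup>2"
    and xi: "0 < \<xi>" "\<And>n. \<xi> * M (2*n+1) \<le> m (2*n)"
    and energy_class: "energy_class V R u ut"
    and weak: "\<And>v t. v \<in> V \<Longrightarrow> t > 0 \<Longrightarrow> t \<notin> range ts \<Longrightarrow>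
        \<exists>a. ((\<lambda>s. ut s \<bullet> v) has_real_derivative a) (at t) \<and>
          a + R (u t) \<bullet> R v + B1 t (adj (B1 t) (ut t)) \<bullet> v
            + B2 t (adj (B2 t) (ut (t - \<tau>))) \<bullet> v = 0"
begin

interpretation j: bounded_linear j by (rule j)

abbreviation U :: "real \<Rightarrow> 'h \<times> 'h" where
  "U t \<equiv> (R (u t), ut t)"

definition E :: "real \<Rightarrow> real" where
  "E t = energy R B2 \<tau> \<xi> u ut t"

text \<open>The two ends of the memory integral: what enters as \<open>future_term\<close> at time
  \<open>t\<close> leaves as \<open>delay_term\<close> at time \<open>t + \<tau>\<close>.\<close>

definition delay_term :: "real \<Rightarrow> real" where
  "delay_term t = (norm (adj (B2 t) (ut (t - \<tau>))))\<^sup>2"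

definition future_term :: "real \<Rightarrow> real" where
  "future_term t = (norm (adj (B2 (t + \<tau>)) (ut t)))\<^sup>2"

lemma future_term_eq: "future_term = delay_term \<circ> (+) \<tau>"
  by (auto simp: future_term_def delay_term_def add.commute)

section \<open>Regularity of the solution and the memory part of the energy\<close>

lemma ts_le: "i \<le> k \<Longrightarrow> ts i \<le> ts k"
  using ts(2) by (simp add: strict_mono_less_eq)

lemma ts_less: "i < k \<Longrightarrow> ts i < ts k"
  using ts(2) by (simp add: strict_mono_less)

lemma ts_nonneg: "0 \<le> ts n"
  using ts_le[of 0 n] ts(1) by simp

lemma not_switching_time:
  assumes "t \<in> {ts n<..<ts (Suc n)}"
  shows "t \<notin> range ts"
proof
  assume "t \<in> range ts"
  then obtain k where "t = ts k" by blast
  then have "n < k" "k < Suc n" using assms ts(2) by (auto simp: strict_mono_less)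
  then show False by simp
qed

lemma ut_cont: "0 \<le> a \<Longrightarrow> continuous_on {a..b} ut"
  using energy_class unfolding energy_class_def by (auto intro: continuous_on_subset)

lemma ut_delay_cont: "\<tau> \<le> a \<Longrightarrow> continuous_on {a..b} (\<lambda>t. ut (t - \<tau>))"
  by (rule continuous_on_compose2[OF ut_cont[of 0 "b - \<tau>"]]) (auto intro!: continuous_intros)

lemma U_cont: "0 \<le> a \<Longrightarrow> continuous_on {a..b} U"
  using energy_class unfolding energy_class_def
  by (intro continuous_on_Pair ut_cont) (auto intro: continuous_on_subset)

lemma square_norm_U: "(norm (U t))\<^sup>2 = (norm (R (u t)))\<^sup>2 + (norm (ut t))\<^sup>2"
  by (simp add: norm_prod_def)

text \<open>The force is prescribed only inside the interval, so the continuous extensions of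
  \<open>B1\<close> and \<open>B2\<close> up to the right end may replace them;
  \<open>energy_identity\<close> asks for a continuous force.\<close>

lemma U_evolves:
  assumes n: "ts n \<le> a" "b \<le> ts (Suc n)"
    and f: "\<And>t. t \<in> {a<..<b} \<Longrightarrow> f t = - (B1 t (adj (B1 t) (ut t))) - B2 t (adj (B2 t) (ut (t - \<tau>)))"
  shows "evolves (\<lambda>t. (0, f t)) U a b"
proof (rule wave_evolves)
  have a0: "0 \<le> a" using ts_nonneg[of n] n by simp
  show "u t \<in> V" if "t \<in> {a..b}" for t
    using energy_class that a0 by (simp add: energy_class_def)
  show "continuous_on {a..b} (\<lambda>t. R (u t))"
    using energy_class a0 unfolding energy_class_def by (auto intro: continuous_on_subset)
  show "(u has_vector_derivative ut t) (at t within {a..b})" if "t \<in> {a..b}" for t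
    by (rule has_vector_derivative_within_subset[of _ _ _ "{0..}"])
      (use energy_class that a0 in \<open>auto simp: energy_class_def\<close>)
  show "continuous_on {a..b} ut" by (rule ut_cont[OF a0])
  fix v t assume v: "v \<in> V" and t: "t \<in> {a<..<b}"
  have "t \<notin> range ts" using t n by (intro not_switching_time[of _ n]) auto
  moreover have "t > 0" using t a0 by simp
  ultimately obtain l where l: "((\<lambda>s. ut s \<bullet> v) has_real_derivative l) (at t)"
    "l + R (u t) \<bullet> R v + B1 t (adj (B1 t) (ut t)) \<bullet> v
            + B2 t (adj (B2 t) (ut (t - \<tau>))) \<bullet> v = 0"
    using weak[OF v] by blast
  have "l = f t \<bullet> v - R (u t) \<bullet> R v" using l(2) by (simp add: f[OF t] inner_diff_left)
  then show "((\<lambda>s. ut s \<bullet> v) has_real_derivative f t \<bullet> v - R (u t) \<bullet> R v) (at t)"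
    using l(1) by simp
qed

lemma delay_term_even: "t \<in> {ts (2*n)..<ts (2*n+1)} \<Longrightarrow> delay_term t = 0"
  using B2_zero by (simp add: delay_term_def adj_zero)

lemma delay_term_nonneg: "0 \<le> delay_term t"
  by (simp add: delay_term_def)

lemma delay_term_integrable_piece: "delay_term integrable_on {ts k..ts (Suc k)}"
proof (cases "even k")
  case True
  then obtain n where n: "k = 2 * n" by blast
  have "(\<lambda>_. 0::real) integrable_on {ts k..ts (Suc k)}" by (rule integrable_0)
  then show ?thesis
    by (rule integrable_spike[of _ _ "{ts (Suc k)}"]) (use delay_term_even[of _ n] n in auto)
next
  case False
  then obtain n where n: "k = 2 * n + 1" using oddE by blast
  obtain F where F: "continuous_on {ts k..ts (Suc k)} F" "\<And>t. t \<in> {ts k..<ts (Suc k)} \<Longrightarrow> F t = B2 t"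
    using B2_C0[of n] n by (auto simp: C0_upto_def)
  \<comment> \<open>A delayed interval starts no earlier than \<tau>, so \<open>ut\<close> is
    evaluated at nonnegative times only, where it is continuous.\<close>
  have "\<tau> \<le> ts k" using ts(3)[of n] ts_nonneg[of "2 * n"] n by simp
  then have "continuous_on {ts k..ts (Suc k)} (\<lambda>t. (norm (adj (F t) (ut (t - \<tau>))))\<^sup>2)"
    by (intro continuous_intros continuous_on_adj F(1) ut_delay_cont)
  then have "(\<lambda>t. (norm (adj (F t) (ut (t - \<tau>))))\<^sup>2) integrable_on {ts k..ts (Suc k)}"
    by (rule integrable_continuous_real)
  then show ?thesis
    by (rule integrable_spike[of _ _ "{ts (Suc k)}"]) (use F(2) in \<open>auto simp: delay_term_def\<close>)
qed

lemma delay_term_integrable: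
  assumes "0 \<le> a"
  shows "delay_term integrable_on {a..b}"
proof -
  have "delay_term integrable_on {0..ts k}" for k
  proof (induction k)
    case 0
    show ?case using has_integral_refl(2)[of delay_term 0] by (auto simp: ts(1) integrable_on_def)
  next
    case (Suc k)
    show ?case
      by (rule Henstock_Kurzweil_Integration.integrable_combine[OF _ _ Suc delay_term_integrable_piece])
        (auto simp: ts_nonneg ts_le)
  qed
  \<comment> \<open>Switching times cannot accumulate: each undelayed interval has length at least
    \<tau>.\<close>
  moreover have "\<exists>k. b \<le> ts k"
  proof -
    have "n * \<tau> \<le> ts (2 * n)" for n :: nat
    proof (induction n)
      case (Suc n)
      have "ts (2 * Suc n) \<ge> ts (2 * n + 1)" by (rule ts_le) simp
      then show ?case using Suc ts(3)[of n] by (simp add: algebra_simps)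
    qed (simp add: ts(1))
    moreover obtain n :: nat where "b / \<tau> \<le> n" using real_arch_simple by blast
    ultimately show ?thesis using tau by (metis order_trans pos_divide_le_eq)
  qed
  ultimately show ?thesis using assms
    by (meson atLeastatMost_subset_iff integrable_on_subinterval)
qed

lemma future_term_integrable: "- \<tau> \<le> a \<Longrightarrow> future_term integrable_on {a..b}"
  using delay_term_integrable[of "a + \<tau>" "b + \<tau>"]
  unfolding integrable_on_def future_term_eq has_integral_shift_Icc_real by simp

lemma integral_future_term: "integral {a..b} future_term = integral {a + \<tau>..b + \<tau>} delay_term"
  unfolding future_term_eq by (rule integral_shift_Icc_real)

lemma E_eq: "E t = (norm (U t))\<^sup>2 / 2 + \<xi> / 2 * integral {t - \<tau>..t} future_term"
  unfolding E_def energy_def square_norm_U future_term_def[abs_def] by simp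

lemma U_le_E:
  assumes "0 \<le> t"
  shows "(norm (U t))\<^sup>2 / 2 \<le> E t"
  using xi(1) assms unfolding E_eq
  by (auto intro!: mult_nonneg_nonneg integral_nonneg future_term_integrable simp: future_term_def)

text \<open>The memory at \<open>ts (2*n)\<close> is the integral of \<open>delay_term\<close> over
  the next \<tau> units of time, and these lie in an undelayed interval.\<close>

lemma E_even:
  "E (ts (2*n)) = (norm (U (ts (2*n))))\<^sup>2 / 2"
proof -
  have "integral {ts (2*n)..ts (2*n) + \<tau>} delay_term \<le> integral {ts (2*n)..ts (2*n) + \<tau>} (\<lambda>_. 0)"
    using ts(3)[of n]
    by (intro integral_le_Ico delay_term_integrable ts_nonneg integrable_0)
      (auto simp: delay_term_even[of _ n])
  moreover have "0 \<le> integral {ts (2*n)..ts (2*n) + \<tau>} delay_term"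
    by (intro integral_nonneg delay_term_integrable ts_nonneg delay_term_nonneg)
  ultimately show ?thesis by (simp add: E_eq integral_future_term)
qed

text \<open>The memory changes by inflow minus outflow. The integrated form is used because the
  integrand may jump.\<close>

lemma E_difference:
  assumes "0 \<le> s" "s \<le> t"
  shows "E t - E s = ((norm (U t))\<^sup>2 - (norm (U s))\<^sup>2) / 2
    + \<xi> / 2 * (integral {s..t} future_term - integral {s..t} delay_term)"
proof -
  have "integral {s - \<tau>..s} future_term + integral {s..t} future_term = integral {s - \<tau>..t} future_term"
    using assms tau by (intro Henstock_Kurzweil_Integration.integral_combine future_term_integrable) auto
  moreover have "integral {s - \<tau>..t - \<tau>} future_term + integral {t - \<tau>..t} future_term
      = integral {s - \<tau>..t} future_term"
    using assms tau by (intro Henstock_Kurzweil_Integration.integral_combine future_term_integrable) auto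
  moreover have "integral {s - \<tau>..t - \<tau>} future_term = integral {s..t} delay_term"
    by (simp add: integral_future_term)
  ultimately have "integral {t - \<tau>..t} future_term - integral {s - \<tau>..s} future_term
      = integral {s..t} future_term - integral {s..t} delay_term" by linarith
  from arg_cong[OF this, of "\<lambda>x. \<xi> / 2 * x"] show ?thesis
    unfolding E_eq by (simp add: right_diff_distrib diff_divide_distrib)
qed

section \<open>Energy estimates on a single damped or delayed interval\<close>

lemma B2_bound':
  assumes t: "t \<in> {ts (2*n)..<ts (2*n+3)}"
  shows "(norm (adj (B2 t) v))\<^sup>2 \<le> M (2*n+1) * (norm (j v))\<^sup>2"
proof -
  have zero: ?thesis if "B2 t = 0"
    using that M_pos[of "2*n+1"] by (simp add: adj_zero)
  consider "t \<in> {ts (2*n)..<ts (2*n+1)}" | "t \<in> {ts (2*n+1)..<ts (2*n+2)}"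
    | "t \<in> {ts (2*Suc n)..<ts (2*Suc n+1)}"
    using t by (fastforce simp: numeral_eq_Suc)
  then show ?thesis
    by cases (use zero B2_zero B2_bound in blast)+
qed

text \<open>The shifted time \<open>t + \<tau>\<close> cannot pass beyond the undelayed interval
  that follows, whose length is at least \<tau>. Hence only the constant of the same period
  occurs.\<close>

lemma future_term_bound:
  assumes t: "t \<in> {ts (2*n)..<ts (2*n+2)}"
  shows "future_term t \<le> M (2*n+1) * (norm (j (ut t)))\<^sup>2"
proof -
  have "ts (2*n+2) + \<tau> \<le> ts (2*n+3)" using ts(3)[of "Suc n"] by (simp add: numeral_eq_Suc)
  then have "t + \<tau> \<in> {ts (2*n)..<ts (2*n+3)}" using t tau by auto
  then show ?thesis unfolding future_term_def by (rule B2_bound')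
qed

lemma j_ut_integrable: "0 \<le> a \<Longrightarrow> (\<lambda>t. k * (norm (j (ut t)))\<^sup>2) integrable_on {a..b}"
  by (intro integrable_continuous_real continuous_intros j.continuous_on ut_cont)

lemma even_interval_evolves:
  obtains F where "continuous_on {ts (2*n)..ts (2*n+1)} F"
    "\<And>t. t \<in> {ts (2*n)..<ts (2*n+1)} \<Longrightarrow> F t = B1 t"
    "evolves (\<lambda>t. (0, - F t (adj (F t) (ut t)))) U (ts (2*n)) (ts (2*n+1))"
proof -
  obtain F where F: "continuous_on {ts (2*n)..ts (2*n+1)} F" "\<And>t. t \<in> {ts (2*n)..<ts (2*n+1)} \<Longrightarrow> F t = B1 t"
    using B1_C0[of n] by (auto simp: C0_upto_def)
  moreover have "evolves (\<lambda>t. (0, - F t (adj (F t) (ut t)))) U (ts (2*n)) (ts (2*n+1))"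
    by (rule U_evolves[of "2*n"]) (simp_all add: F(2) B2_zero[of _ n])
  ultimately show thesis by (rule that)
qed

text \<open>Half of the damping absorbs the inflow into the memory, since
  \<open>\<xi> * M (2*n+1) \<le> m (2*n)\<close>; the other half is the term with
  \<open>m (2*n) / 2\<close>. The outflow has a favourable sign.\<close>

lemma even_interval_decay:
  assumes st: "ts (2*n) \<le> s" "s \<le> t" "t \<le> ts (2*n+1)"
  shows "E t + m (2*n) / 2 * integral {s..t} (\<lambda>r. (norm (j (ut r)))\<^sup>2) \<le> E s"
proof -
  obtain F where F: "continuous_on {ts (2*n)..ts (2*n+1)} F"
    "\<And>t. t \<in> {ts (2*n)..<ts (2*n+1)} \<Longrightarrow> F t = B1 t"
    "evolves (\<lambda>t. (0, - F t (adj (F t) (ut t)))) U (ts (2*n)) (ts (2*n+1))"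
    using even_interval_evolves[of n] by blast
  have s0: "0 \<le> s" using st(1) ts_nonneg[of "2*n"] by simp
  define g where "g r = U r \<bullet> (0, - F r (adj (F r) (ut r)))" for r
  have g_eq: "g r = - (norm (adj (F r) (ut r)))\<^sup>2" for r
    by (simp add: g_def inner_prod_def adj_inner inner_commute[of "ut r"] power2_norm_eq_inner)
  have id: "((\<lambda>r. 2 * g r) has_integral (norm (U t))\<^sup>2 - (norm (U s))\<^sup>2) {s..t}"
    unfolding g_def using F(1) ts_nonneg[of "2*n"]
    by (intro energy_identity[OF F(3) _ st] continuous_intros
        bounded_bilinear.continuous_on[OF bounded_bilinear_blinfun_apply] continuous_on_adj ut_cont)
  have ints: "(\<lambda>r. 2 * g r) integrable_on {s..t}" "(\<lambda>r. \<xi> * future_term r) integrable_on {s..t}"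
    using id tau s0
    by (blast, intro integrable_on_mult_right future_term_integrable, linarith)
  have int: "(\<lambda>r. 2 * g r + \<xi> * future_term r) integrable_on {s..t}"
    by (intro integrable_add ints)
  have "integral {s..t} (\<lambda>r. 2 * g r + \<xi> * future_term r)
      = integral {s..t} (\<lambda>r. 2 * g r) + integral {s..t} (\<lambda>r. \<xi> * future_term r)"
    by (intro integral_add ints)
  then have eq: "integral {s..t} (\<lambda>r. 2 * g r + \<xi> * future_term r)
      = (norm (U t))\<^sup>2 - (norm (U s))\<^sup>2 + \<xi> * integral {s..t} future_term"
    using integral_unique[OF id] by simp
  have "integral {s..t} (\<lambda>r. 2 * g r + \<xi> * future_term r)
      \<le> integral {s..t} (\<lambda>r. - m (2*n) * (norm (j (ut r)))\<^sup>2)"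
  proof (rule integral_le_Ico[OF int j_ut_integrable[OF s0]])
    fix r assume "r \<in> {s..<t}"
    then have r: "r \<in> {ts (2*n)..<ts (2*n+1)}" using st by auto
    have "m (2*n) * (norm (j (ut r)))\<^sup>2 \<le> - g r"
      using B1_bounds[OF r, of "ut r"] by (simp add: g_eq F(2)[OF r])
    moreover have "\<xi> * future_term r \<le> \<xi> * (M (2*n+1) * (norm (j (ut r)))\<^sup>2)"
      using r ts_less[of "2*n+1" "2*n+2"] xi(1) by (intro mult_left_mono future_term_bound) auto
    moreover have "\<xi> * M (2*n+1) * (norm (j (ut r)))\<^sup>2 \<le> m (2*n) * (norm (j (ut r)))\<^sup>2"
      by (intro mult_right_mono xi) simp
    ultimately show "2 * g r + \<xi> * future_term r \<le> - m (2*n) * (norm (j (ut r)))\<^sup>2" by simp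
  qed
  also have "\<dots> = - m (2*n) * integral {s..t} (\<lambda>r. (norm (j (ut r)))\<^sup>2)" by simp
  finally have le: "(norm (U t))\<^sup>2 - (norm (U s))\<^sup>2 + \<xi> * integral {s..t} future_term
      \<le> - m (2*n) * integral {s..t} (\<lambda>r. (norm (j (ut r)))\<^sup>2)" unfolding eq .
  have "0 \<le> \<xi> * integral {s..t} delay_term"
    using s0 xi(1) by (intro mult_nonneg_nonneg integral_nonneg delay_term_integrable delay_term_nonneg) auto
  with le E_difference[OF s0 st(2)] show ?thesis by (simp add: field_simps)
qed

text \<open>In the rate, \<open>1 / \<xi>\<close> comes from Young's inequality for the feedback and
  \<open>\<xi>\<close> from the inflow into the memory; \<open>C\<close> passes from the norm of
  \<open>j (ut r)\<close> to that of \<open>ut r\<close>. The minorant for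
  \<open>gronwall_integral\<close> is the energy without its memory.\<close>

lemma odd_interval_growth:
  assumes st: "ts (2*n+1) \<le> t" "t \<le> ts (2*n+2)"
  shows "E t \<le> exp ((\<xi> + 1 / \<xi>) * C * M (2*n+1) * (t - ts (2*n+1))) * E (ts (2*n+1))"
proof (rule gronwall_integral[where b = "ts (2*n+2)" and y = "\<lambda>t. (norm (U t))\<^sup>2 / 2"])
  define k where "k = (\<xi> + 1 / \<xi>) * C * M (2*n+1)"
  show "continuous_on {ts (2*n+1)..ts (2*n+2)} (\<lambda>t. (norm (U t))\<^sup>2 / 2)"
    by (intro continuous_intros U_cont ts_nonneg) simp
  show "0 \<le> (\<xi> + 1 / \<xi>) * C * M (2*n+1)"
    using xi(1) C(1) M_pos[of "2*n+1"] by simp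
  show "(norm (U t))\<^sup>2 / 2 \<le> E t" if "t \<in> {ts (2*n+1)..ts (2*n+2)}" for t
    using that ts_nonneg[of "2*n+1"] by (intro U_le_E) auto
  show "t \<in> {ts (2*n+1)..ts (2*n+2)}" using st by simp
  fix t assume t: "t \<in> {ts (2*n+1)..ts (2*n+2)}"
  define s where "s = ts (2*n+1)"
  have s0: "0 \<le> s" "\<tau> \<le> s"
    using ts(3)[of n] ts_nonneg[of "2*n"] ts_nonneg[of "2*n+1"] by (auto simp: s_def)
  obtain F where F: "continuous_on {ts (2*n+1)..ts (2*n+2)} F"
    "\<And>t. t \<in> {ts (2*n+1)..<ts (2*n+2)} \<Longrightarrow> F t = B2 t"
    using B2_C0[of n] by (auto simp: C0_upto_def)
  have ev: "evolves (\<lambda>t. (0, - F t (adj (F t) (ut (t - \<tau>))))) U (ts (2*n+1)) (ts (2*n+2))"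
    by (rule U_evolves[of "2*n+1"]) (simp_all add: F(2) B1_zero[of _ n])
  define g where "g r = U r \<bullet> (0, - F r (adj (F r) (ut (r - \<tau>))))" for r
  have g_eq: "g r = - (adj (F r) (ut (r - \<tau>)) \<bullet> adj (F r) (ut r))" for r
    by (simp add: g_def inner_prod_def adj_inner inner_commute[of "ut r"])
  have st': "ts (2*n+1) \<le> s" "s \<le> t" "t \<le> ts (2*n+2)" using t by (auto simp: s_def)
  have id: "((\<lambda>r. 2 * g r) has_integral (norm (U t))\<^sup>2 - (norm (U s))\<^sup>2) {s..t}"
    unfolding g_def using F(1) s0
    by (intro energy_identity[OF ev _ st'] continuous_intros
        bounded_bilinear.continuous_on[OF bounded_bilinear_blinfun_apply] continuous_on_adj ut_delay_cont)
      (auto simp: s_def)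
  have ints: "(\<lambda>r. 2 * g r) integrable_on {s..t}" "(\<lambda>r. \<xi> * future_term r) integrable_on {s..t}"
      "(\<lambda>r. \<xi> * delay_term r) integrable_on {s..t}"
    using id tau s0
    by (blast, intro integrable_on_mult_right future_term_integrable, linarith,
        intro integrable_on_mult_right delay_term_integrable)
  have int: "(\<lambda>r. 2 * g r + \<xi> * future_term r - \<xi> * delay_term r) integrable_on {s..t}"
    by (intro integrable_diff integrable_add ints)
  have "integral {s..t} (\<lambda>r. 2 * g r + \<xi> * future_term r - \<xi> * delay_term r)
      = integral {s..t} (\<lambda>r. 2 * g r) + integral {s..t} (\<lambda>r. \<xi> * future_term r)
        - integral {s..t} (\<lambda>r. \<xi> * delay_term r)"
    by (simp add: integral_add integral_diff integrable_add ints)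
  also have "\<dots> = (norm (U t))\<^sup>2 - (norm (U s))\<^sup>2
      + \<xi> * (integral {s..t} future_term - integral {s..t} delay_term)"
    unfolding integral_unique[OF id] by (simp add: algebra_simps)
  also have "\<dots> = 2 * (E t - E s)"
    unfolding E_difference[OF s0(1) st'(2)] by (simp add: field_simps)
  finally have "2 * (E t - E s) = integral {s..t} (\<lambda>r. 2 * g r + \<xi> * future_term r - \<xi> * delay_term r)"
    by (rule sym)
  also have "\<dots> \<le> integral {s..t} (\<lambda>r. 2 * k * ((norm (U r))\<^sup>2 / 2))"
  proof (rule integral_le_Ico[OF int])
    show "(\<lambda>r. 2 * k * ((norm (U r))\<^sup>2 / 2)) integrable_on {s..t}"
      by (intro integrable_continuous_real continuous_intros U_cont s0) simp
    fix r assume "r \<in> {s..<t}"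
    then have r: "r \<in> {ts (2*n+1)..<ts (2*n+2)}" using st' by auto
    define x where "x = adj (F r) (ut r)"
    define y where "y = adj (F r) (ut (r - \<tau>))"
    \<comment> \<open>Young's inequality with only \<open>x\<close> scaled: after multiplication by
      \<xi> the term in \<open>y\<close> is \<open>\<xi> * delay_term r\<close>, exactly what the
      memory releases at that moment.\<close>
    have "0 \<le> (norm ((1 / \<xi>) *\<^sub>R x + y))\<^sup>2" by simp
    also have "\<dots> = 1 / \<xi> * (1 / \<xi>) * (norm x)\<^sup>2 + 2 / \<xi> * (y \<bullet> x) + (norm y)\<^sup>2"
      unfolding power2_norm_eq_inner inner_add_left inner_add_right inner_scaleR_left inner_scaleR_right
        inner_commute[of x y] by algebra
    finally have "0 \<le> \<xi> * (1 / \<xi> * (1 / \<xi>) * (norm x)\<^sup>2 + 2 / \<xi> * (y \<bullet> x) + (norm y)\<^sup>2)"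
      using xi(1) by simp
    also have "\<dots> = 1 / \<xi> * (norm x)\<^sup>2 + 2 * (y \<bullet> x) + \<xi> * (norm y)\<^sup>2"
      using xi(1) by (simp add: field_simps power2_eq_square)
    finally have "2 * g r - \<xi> * delay_term r \<le> 1 / \<xi> * (norm x)\<^sup>2"
      by (simp add: g_eq delay_term_def x_def y_def F(2)[OF r])
    also have "\<dots> \<le> 1 / \<xi> * (M (2*n+1) * (norm (j (ut r)))\<^sup>2)"
      unfolding x_def F(2)[OF r] using xi(1) by (intro mult_left_mono B2_bound r) simp
    finally have "2 * g r + \<xi> * future_term r - \<xi> * delay_term r
        \<le> 1 / \<xi> * (M (2*n+1) * (norm (j (ut r)))\<^sup>2) + \<xi> * future_term r" by simp
    also have "\<xi> * future_term r \<le> \<xi> * (M (2*n+1) * (norm (j (ut r)))\<^sup>2)"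
      using xi(1) r ts_less[of "2*n" "2*n+1"] by (intro mult_left_mono future_term_bound) auto
    also have "1 / \<xi> * (M (2*n+1) * (norm (j (ut r)))\<^sup>2) + \<xi> * (M (2*n+1) * (norm (j (ut r)))\<^sup>2)
        = (\<xi> + 1 / \<xi>) * M (2*n+1) * (norm (j (ut r)))\<^sup>2" by (simp add: algebra_simps)
    also have "\<dots> \<le> (\<xi> + 1 / \<xi>) * M (2*n+1) * (C * (norm (U r))\<^sup>2)"
    proof (intro mult_left_mono)
      have "C * (norm (ut r))\<^sup>2 \<le> C * (norm (U r))\<^sup>2"
        using C(1) by (intro mult_left_mono) (simp_all add: square_norm_U)
      then show "(norm (j (ut r)))\<^sup>2 \<le> C * (norm (U r))\<^sup>2" using C(2)[of "ut r"] by linarith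
    qed (use xi(1) M_pos[of "2*n+1"] in simp)
    finally show "2 * g r + \<xi> * future_term r - \<xi> * delay_term r \<le> 2 * k * ((norm (U r))\<^sup>2 / 2)"
      by (simp add: k_def mult_ac)
  qed
  also have "\<dots> = 2 * (k * integral {s..t} (\<lambda>r. (norm (U r))\<^sup>2 / 2))" by simp
  finally have "E t - E s \<le> k * integral {s..t} (\<lambda>r. (norm (U r))\<^sup>2 / 2)"
    by (rule mult_left_le_imp_le) simp
  then show "E t \<le> E (ts (2*n+1)) + (\<xi> + 1 / \<xi>) * C * M (2*n+1) *
      integral {ts (2*n+1)..t} (\<lambda>r. (norm (U r))\<^sup>2 / 2)"
    unfolding k_def s_def by (simp only: diff_le_eq add.commute)
qed

text \<open>By \<open>E_even\<close> the observability hypothesis bounds the whole energy at the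
  left end; time is shifted so that the comparison wave starts at 0. The factor 2 is that of
  \<open>observability_estimate\<close>.\<close>

lemma even_interval_observability:
  assumes obs: "\<And>w0 w1 w wt. w0 \<in> V \<Longrightarrow> wave_solution V R w0 w1 w wt \<Longrightarrow>
      1 / 2 * ((norm (R w0))\<^sup>2 + (norm w1)\<^sup>2) \<le> c * integral {0..T} (\<lambda>s. (norm (j (wt s)))\<^sup>2)"
    and c: "0 < c" and T: "T = ts (2*n+1) - ts (2*n)"
  shows "E (ts (2*n)) \<le> 2 * c * (1 + 4 * C\<^sup>2 * T\<^sup>2 * (M (2*n))\<^sup>2) *
    integral {ts (2*n)..ts (2*n+1)} (\<lambda>s. (norm (j (ut s)))\<^sup>2)"
proof -
  define a where "a = ts (2*n)"
  have aT: "ts (2*n+1) = T + a" "0 \<le> a" "0 \<le> T"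
    using T ts_nonneg[of "2*n"] ts_le[of "2*n" "2*n+1"] by (simp_all add: a_def)
  obtain F where F: "continuous_on {a..T + a} F" "\<And>t. t \<in> {a..<T + a} \<Longrightarrow> F t = B1 t"
    "evolves (\<lambda>t. (0, - F t (adj (F t) (ut t)))) U a (T + a)"
    using even_interval_evolves[of n] unfolding aT a_def[symmetric] by blast
  have "u a \<in> V" using energy_class aT by (simp add: energy_class_def)
  then obtain w wt where w: "wave_solution V R (u a) (ut a) w wt"
    "\<And>b. evolves (\<lambda>_. 0) (\<lambda>t. (R (w t), wt t)) 0 b"
    using free_wave_exists by blast
  have "E a = 1 / 2 * ((norm (R (u a)))\<^sup>2 + (norm (ut a))\<^sup>2)"
    unfolding a_def E_even square_norm_U by simp
  also have "\<dots> \<le> c * integral {0..T} (\<lambda>s. (norm (j (wt s)))\<^sup>2)"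
    by (rule obs[OF \<open>u a \<in> V\<close> w(1)])
  also have "\<dots> \<le> c * (2 * (1 + 4 * C\<^sup>2 * T\<^sup>2 * (M (2*n))\<^sup>2) *
      integral {0..T} (\<lambda>t. (norm (j (ut (a + t))))\<^sup>2))"
  proof (intro mult_left_mono)
    have "integral {0..T} (\<lambda>t. (norm (j (snd (R (w t), wt t))))\<^sup>2)
      \<le> 2 * (1 + 4 * C\<^sup>2 * T\<^sup>2 * (M (2*n))\<^sup>2) * integral {0..T} (\<lambda>t. (norm (j (snd (U (a + t)))))\<^sup>2)"
    proof (rule observability_estimate[where B = "\<lambda>t. F (a + t)"])
      show "continuous_on {0..T} (\<lambda>t. F (a + t))"
        by (rule continuous_on_compose2[OF F(1)]) (auto intro!: continuous_intros)
      show "evolves (\<lambda>t. (0, - F (a + t) (adj (F (a + t)) (snd (U (a + t)))))) (\<lambda>t. U (a + t)) 0 T"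
        using evolves_shift[of _ _ 0 a T] F(3) by simp
      show "evolves (\<lambda>_. 0) (\<lambda>t. (R (w t), wt t)) 0 T" by (rule w(2))
      show "(R (w 0), wt 0) = U (a + 0)" using w(1) by (simp add: wave_solution_def)
      show "(norm (adj (F (a + t)) v))\<^sup>2 \<le> M (2*n) * (norm (j v))\<^sup>2" if "t \<in> {0..<T}" for t v
        using B1_bounds[of "a + t" n v] that F(2)[of "a + t"] aT by (simp add: a_def)
    qed (use aT(3) j C M_pos[of "2*n"] in \<open>auto intro: less_imp_le\<close>)
    then show "integral {0..T} (\<lambda>s. (norm (j (wt s)))\<^sup>2)
        \<le> 2 * (1 + 4 * C\<^sup>2 * T\<^sup>2 * (M (2*n))\<^sup>2) * integral {0..T} (\<lambda>t. (norm (j (ut (a + t))))\<^sup>2)"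
      by simp
  qed (use c in simp)
  also have "integral {0..T} (\<lambda>t. (norm (j (ut (a + t))))\<^sup>2) = integral {a..T + a} (\<lambda>s. (norm (j (ut s)))\<^sup>2)"
    using integral_shift_Icc_real[of 0 T "\<lambda>s. (norm (j (ut s)))\<^sup>2" a] by (simp add: o_def)
  finally show ?thesis unfolding aT a_def by (simp add: mult_ac)
qed

text \<open>With \<open>I\<close> the observed velocity, observability bounds the initial energy by
  \<open>K / 2 * I\<close>, and decay bounds \<open>m (2*n) / 2 * I\<close> by the energy loss.
  Eliminating \<open>I\<close> gives the quotient.\<close>

lemma even_interval_contraction:
  assumes obs: "\<And>w0 w1 w wt. w0 \<in> V \<Longrightarrow> wave_solution V R w0 w1 w wt \<Longrightarrow>
      1 / 2 * ((norm (R w0))\<^sup>2 + (norm w1)\<^sup>2) \<le> c * integral {0..T} (\<lambda>s. (norm (j (wt s)))\<^sup>2)"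
    and c: "0 < c" and T: "T = ts (2*n+1) - ts (2*n)"
    and K: "K = 4 * c * (1 + 4 * C\<^sup>2 * T\<^sup>2 * (M (2*n))\<^sup>2)" and m: "0 < m (2*n)"
  shows "E (ts (2*n+1)) \<le> K / (m (2*n) + K) * E (ts (2*n))"
proof -
  define I where "I = integral {ts (2*n)..ts (2*n+1)} (\<lambda>s. (norm (j (ut s)))\<^sup>2)"
  have K0: "0 < K" using c by (simp add: K add_pos_nonneg)
  have dec: "E (ts (2*n+1)) + m (2*n) / 2 * I \<le> E (ts (2*n))"
    using even_interval_decay[of n "ts (2*n)" "ts (2*n+1)"] ts_le[of "2*n" "2*n+1"] by (simp add: I_def)
  have I0: "0 \<le> I" unfolding I_def
    using j_ut_integrable[OF ts_nonneg, of 1] by (intro integral_nonneg) auto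
  then have "0 \<le> m (2*n) / 2 * I" using m by simp
  then have "E (ts (2*n+1)) \<le> E (ts (2*n))" using dec by linarith
  also have "E (ts (2*n)) \<le> 2 * c * (1 + 4 * C\<^sup>2 * T\<^sup>2 * (M (2*n))\<^sup>2) * I"
    unfolding I_def by (rule even_interval_observability[OF _ c T]) (rule obs)
  also have "\<dots> = K / 2 * I" by (simp add: K)
  finally have "m (2*n) * E (ts (2*n+1)) \<le> m (2*n) * (K / 2 * I)"
    using m by (intro mult_left_mono) auto
  also have "\<dots> = K * (m (2*n) / 2 * I)" by simp
  also have "\<dots> \<le> K * (E (ts (2*n)) - E (ts (2*n+1)))"
    using dec K0 by (intro mult_left_mono) auto
  finally have "(m (2*n) + K) * E (ts (2*n+1)) \<le> K * E (ts (2*n))" by (simp add: algebra_simps)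
  then show ?thesis using m K0 by (simp add: field_simps)
qed

section \<open>Iteration over the periods\<close>

lemma E_nonneg: "0 \<le> t \<Longrightarrow> 0 \<le> E t"
  using U_le_E[of t] by (smt (verit) divide_nonneg_pos zero_le_power2)

text \<open>The growth factor increases with time, so its value at the end of the delayed interval
  serves for all of it. The two cases stay apart because \<open>d\<close> is not compared with 1 at
  this stage.\<close>

lemma period_estimate:
  assumes q: "E (ts (2*n+1)) \<le> q * E (ts (2*n))"
    and d: "exp ((\<xi> + 1 / \<xi>) * C * M (2*n+1) * (ts (2*n+2) - ts (2*n+1))) * q \<le> d"
    and m: "0 \<le> m (2*n)" and t: "ts (2*n) \<le> t" "t \<le> ts (2*n+2)"
  shows "E t \<le> E (ts (2*n)) \<or> E t \<le> d * E (ts (2*n))"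
    and "E (ts (2*n+2)) \<le> d * E (ts (2*n))"
proof -
  have odd: "E r \<le> d * E (ts (2*n))" if r: "ts (2*n+1) \<le> r" "r \<le> ts (2*n+2)" for r
  proof -
    define k where "k = (\<xi> + 1 / \<xi>) * C * M (2*n+1)"
    have k0: "0 \<le> k" using xi(1) C(1) M_pos[of "2*n+1"] by (simp add: k_def)
    have "E r \<le> exp (k * (r - ts (2*n+1))) * E (ts (2*n+1))"
      unfolding k_def by (rule odd_interval_growth[OF r])
    also have "\<dots> \<le> exp (k * (ts (2*n+2) - ts (2*n+1))) * E (ts (2*n+1))"
      using r(2) k0 E_nonneg[OF ts_nonneg] by (intro mult_right_mono) (auto intro: mult_left_mono)
    also have "\<dots> \<le> exp (k * (ts (2*n+2) - ts (2*n+1))) * (q * E (ts (2*n)))"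
      by (intro mult_left_mono q) simp
    also have "\<dots> \<le> d * E (ts (2*n))"
      using mult_right_mono[OF d E_nonneg[OF ts_nonneg[of "2*n"]]] by (simp add: k_def mult_ac)
    finally show ?thesis .
  qed
  show "E (ts (2*n+2)) \<le> d * E (ts (2*n))"
    by (rule odd) (auto intro: ts_le)
  have "E t \<le> E (ts (2*n))" if "t \<le> ts (2*n+1)"
  proof -
    have "0 \<le> m (2*n) / 2 * integral {ts (2*n)..t} (\<lambda>r. (norm (j (ut r)))\<^sup>2)"
      using m j_ut_integrable[OF ts_nonneg, of 1]
      by (intro mult_nonneg_nonneg integral_nonneg) auto
    then show ?thesis using even_interval_decay[OF order_refl t(1) that] by linarith
  qed
  then show "E t \<le> E (ts (2*n)) \<or> E t \<le> d * E (ts (2*n))"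
    using odd[of t] t(2) by linarith
qed

text \<open>After \<open>n\<close> completed periods the factor is \<open>d ^ n\<close>. As
  \<open>t / P \<le> n + 1\<close>, the power \<open>d ^ Suc n\<close> is at most
  \<open>d powr (t / P)\<close>, and the surplus factor \<open>d\<close> of the unfinished period
  becomes the prefactor \<open>1 / d\<close>.\<close>

lemma exponential_decay:
  fixes P :: real
  assumes period: "\<And>n. ts (2*n) = real n * P"
    and q: "\<And>n. E (ts (2*n+1)) \<le> q n * E (ts (2*n))"
    and d: "\<And>n. exp ((\<xi> + 1 / \<xi>) * C * M (2*n+1) * (ts (2*n+2) - ts (2*n+1))) * q n \<le> d"
    and m: "\<And>n. 0 \<le> m (2*n)" and d01: "0 < d" "d < 1" and t: "0 \<le> t"
  shows "E t \<le> 1 / d * exp (- (- ln d / P) * t) * E 0"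
proof -
  have P: "0 < P" using period[of 1] ts_less[of 0 2] ts(1) by simp
  have at_period: "E (ts (2*n)) \<le> d ^ n * E 0" for n
  proof (induction n)
    case (Suc n)
    have "E (ts (2 * Suc n)) \<le> d * E (ts (2*n))"
      using period_estimate(2)[OF q d m order_refl, of n] ts_le[of "2*n" "2*n+2"] by simp
    also have "\<dots> \<le> d * (d ^ n * E 0)" using d01 by (intro mult_left_mono Suc) simp
    finally show ?case by (simp add: mult_ac)
  qed (simp add: ts(1))
  define n where "n = nat \<lfloor>t / P\<rfloor>"
  have n: "n \<le> t / P" "t / P \<le> real (Suc n)"
    using t P by (auto simp: n_def of_nat_nat) linarith+
  then have "n * P \<le> t" "t \<le> real (Suc n) * P" using P by (auto simp: field_simps)
  then have tn: "ts (2*n) \<le> t" "t \<le> ts (2*n+2)"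
    using period[of n] period[of "Suc n"] by (simp_all add: algebra_simps)
  have E0: "0 \<le> E (ts (2*n))" by (rule E_nonneg[OF ts_nonneg])
  then have "d * E (ts (2*n)) \<le> E (ts (2*n))" using d01 by (simp add: mult_left_le_one_le)
  then have "E t \<le> E (ts (2*n))"
    using period_estimate(1)[OF q d m tn] by linarith
  also have "\<dots> \<le> d ^ n * E 0" by (rule at_period)
  also have "\<dots> \<le> (1 / d * exp (- (- ln d / P) * t)) * E 0"
  proof (rule mult_right_mono)
    have "d ^ Suc n = d powr real (Suc n)" using d01 by (simp only: powr_realpow)
    also have "\<dots> \<le> d powr (t / P)" using d01 n(2) by (intro powr_mono') auto
    also have "\<dots> = exp (- (- ln d / P) * t)" using d01 by (simp add: powr_def mult_ac)
    finally show "d ^ n \<le> 1 / d * exp (- (- ln d / P) * t)" using d01 by (simp add: field_simps)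
  qed (simp add: E_nonneg)
  finally show ?thesis .
qed

end

theorem theorem3p4:
  fixes D V :: "'h::{real_inner, complete_space} set"
    and A R :: "'h \<Rightarrow> 'h"
    and j :: "'h \<Rightarrow> 'w::{real_inner, complete_space}"
    and B1 :: "real \<Rightarrow> 'u1::{real_inner, complete_space} \<Rightarrow>\<^sub>L 'h"
    and B2 :: "real \<Rightarrow> 'u2::{real_inner, complete_space} \<Rightarrow>\<^sub>L 'h"
    and ts :: "nat \<Rightarrow> real"
    and m M cn :: "nat \<Rightarrow> real"
    and c :: "real \<Rightarrow> real"
    and \<tau> \<xi> C Tbar Tstar Ttilde d :: real
  assumes A: "positive_self_adjoint D A" "has_compact_inverse D A"
    and V: "is_square_root V R D A"
    and tau: "\<tau> > 0"
    and ts: "ts 0 = 0" "strict_mono ts" "\<And>n. ts (2*n+1) - ts (2*n) \<ge> \<tau>"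
    and B2_zero: "\<And>n t. t \<in> {ts (2*n)..<ts (2*n+1)} \<Longrightarrow> B2 t = 0"
    and B1_zero: "\<And>n t. t \<in> {ts (2*n+1)..<ts (2*n+2)} \<Longrightarrow> B1 t = 0"
    and B1_C1: "\<And>n. C1_upto (ts (2*n)) (ts (2*n+1)) B1"
    and B2_C0: "\<And>n. C0_upto (ts (2*n+1)) (ts (2*n+2)) B2"
    and W: "bounded_linear j" "inj j" "C > 0"
      "\<And>v. (norm (j v))\<^sup>2 \<le> C * (norm v)\<^sup>2"
    and constants: "\<And>n. 0 < m (2*n)" "\<And>n. m (2*n) \<le> M (2*n)" "\<And>n. 0 < M (2*n+1)"
    and B1_bounds: "\<And>n t v. t \<in> {ts (2*n)..<ts (2*n+1)} \<Longrightarrow>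
        m (2*n) * (norm (j v))\<^sup>2 \<le> (norm (adj (B1 t) v))\<^sup>2 \<and>
        (norm (adj (B1 t) v))\<^sup>2 \<le> M (2*n) * (norm (j v))\<^sup>2"
    and B2_bound: "\<And>n t v. t \<in> {ts (2*n+1)..<ts (2*n+2)} \<Longrightarrow>
        (norm (adj (B2 t) v))\<^sup>2 \<le> M (2*n+1) * (norm (j v))\<^sup>2"
    and inf_pos: "(INF n. m (2*n) / M (2*n+1)) > 0"
    and xi: "0 < \<xi>" "\<xi> < (INF n. m (2*n) / M (2*n+1))"
    and Tbar: "Tbar > 0"
    and observability: "\<And>T. T > Tbar \<Longrightarrow> c T > 0 \<and>
        (\<forall>w0\<in>V. \<forall>w1 w wt. wave_solution V R w0 w1 w wt \<longrightarrow>
          1 / 2 * ((norm (R w0))\<^sup>2 + (norm w1)\<^sup>2)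
            \<le> c T * integral {0..T} (\<lambda>s. (norm (j (wt s)))\<^sup>2))"
    and T_even: "\<And>n. ts (2*n+1) - ts (2*n) = Tstar" "Tstar > Tbar" "Tstar \<ge> \<tau>"
    and T_odd: "\<And>n. ts (2*n+2) - ts (2*n+1) = Ttilde"
    and cn: "\<And>n. cn n =
        4 * c Tstar * (1 + 4 * C\<^sup>2 * (ts (2*n+1) - ts (2*n))\<^sup>2 * (M (2*n))\<^sup>2)
        / (m (2*n) + 4 * c Tstar * (1 + 4 * C\<^sup>2 * (ts (2*n+1) - ts (2*n))\<^sup>2 * (M (2*n))\<^sup>2))"
    and sup: "bdd_above (range (\<lambda>n. exp ((\<xi> + 1 / \<xi>) * C * M (2*n+1) * Ttilde) * cn n))"
      "(SUP n. exp ((\<xi> + 1 / \<xi>) * C * M (2*n+1) * Ttilde) * cn n) = d" "d < 1"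
  shows "\<exists>\<gamma>>0. \<exists>\<mu>>0. \<forall>u0\<in>V. \<forall>u1 u ut. delayed_solution V R B1 B2 \<tau> ts u0 u1 u ut \<longrightarrow>
    (\<forall>t>0. energy R B2 \<tau> \<xi> u ut t \<le> \<gamma> * exp (- \<mu> * t) * energy R B2 \<tau> \<xi> u ut 0)"
proof -
  obtain S where S: "wave_space V R S" using wave_space_inverse_root[OF A(2) V] .
  have M_pos: "0 < M n" for n
  proof (cases "even n")
    case True
    then obtain k where "n = 2 * k" by blast
    then show ?thesis using constants(1)[of k] constants(2)[of k] by simp
  next
    case False
    then obtain k where "n = 2 * k + 1" using oddE by blast
    then show ?thesis using constants(3)[of k] by simp
  qed
  have xi_le: "\<xi> * M (2*n+1) \<le> m (2*n)" for n
  proof -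
    \<comment> \<open>\<open>INF\<close> over the reals is a lower bound once the set is bounded
      below, here by 0.\<close>
    have "bdd_below (range (\<lambda>n. m (2*n) / M (2*n+1)))"
      using constants by (intro bdd_belowI2[of _ 0]) (simp add: less_imp_le)
    then have "(INF n. m (2*n) / M (2*n+1)) \<le> m (2*n) / M (2*n+1)" by (rule cINF_lower) simp
    then have "\<xi> \<le> m (2*n) / M (2*n+1)" using xi(2) by linarith
    then show ?thesis using M_pos[of "2*n+1"] by (simp add: field_simps)
  qed
  have B1_C0: "C0_upto (ts (2*n)) (ts (2*n+1)) B1" for n
    using B1_C1[of n] unfolding C1_upto_def C0_upto_def
    by (blast intro: C1_differentiable_imp_continuous_on)
  have c: "0 < c Tstar"
    and obs: "\<And>w0 w1 w wt. w0 \<in> V \<Longrightarrow> wave_solution V R w0 w1 w wt \<Longrightarrow>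
      1 / 2 * ((norm (R w0))\<^sup>2 + (norm w1)\<^sup>2) \<le> c Tstar * integral {0..Tstar} (\<lambda>s. (norm (j (wt s)))\<^sup>2)"
    using observability[OF T_even(2)] by blast+
  have cn_pos: "0 < cn n" for n
  proof -
    have "0 < 4 * c Tstar * (1 + 4 * C\<^sup>2 * (ts (2*n+1) - ts (2*n))\<^sup>2 * (M (2*n))\<^sup>2)"
      using c by (intro mult_pos_pos add_pos_nonneg) auto
    then show ?thesis unfolding cn using constants(1)[of n] by (intro divide_pos_pos add_pos_pos)
  qed
  \<comment> \<open>Boundedness from \<open>sup(1)\<close> turns the supremum \<open>d\<close> into
    an upper bound for each term.\<close>
  have d: "exp ((\<xi> + 1 / \<xi>) * C * M (2*n+1) * (ts (2*n+2) - ts (2*n+1))) * cn n \<le> d" for n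
    unfolding T_odd using cSUP_upper[OF UNIV_I sup(1), of n] sup(2) by simp
  \<comment> \<open>Gives \<open>ln d\<close> in the decay rate its meaning; \<open>d\<close>
    dominates the positive term of index 0.\<close>
  have d0: "0 < d"
    by (rule less_le_trans[OF mult_pos_pos[OF exp_gt_zero cn_pos] d[of 0]])
  define P where "P = Tstar + Ttilde"
  have period: "ts (2*n) = real n * P" for n
  proof (induction n)
    case (Suc n)
    then show ?case using T_even(1)[of n] T_odd[of n] by (simp add: P_def algebra_simps)
  qed (simp add: ts)
  have P: "0 < P" using period[of 1] ts(1) strict_monoD[OF ts(2), of 0 2] by simp
  \<comment> \<open>\<open>d\<close> and \<open>P\<close> are fixed before any solution is chosen,
    so the constants are uniform in the data.\<close>
  have decay: "energy R B2 \<tau> \<xi> u ut t \<le> 1 / d * exp (- (- ln d / P) * t) * energy R B2 \<tau> \<xi> u ut 0"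
    if u: "delayed_solution V R B1 B2 \<tau> ts u0 u1 u ut" and t: "t > 0" for u0 u1 u ut t
  proof -
    interpret delayed_wave V R S j B1 B2 ts m M \<tau> \<xi> C u ut
    proof (rule delayed_wave.intro[OF S], rule delayed_wave_axioms.intro)
      show "energy_class V R u ut" using u by (simp add: delayed_solution_def)
      show "\<exists>a. ((\<lambda>s. ut s \<bullet> v) has_real_derivative a) (at t) \<and>
          a + R (u t) \<bullet> R v + B1 t (adj (B1 t) (ut t)) \<bullet> v
            + B2 t (adj (B2 t) (ut (t - \<tau>))) \<bullet> v = 0"
        if "v \<in> V" "t > 0" "t \<notin> range ts" for v t
        using u that by (simp add: delayed_solution_def)
    qed (fact tau ts B2_zero B1_zero B1_C0 B2_C0 W M_pos B1_bounds B2_bound xi xi_le)+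
    have "E (ts (2*n+1)) \<le> cn n * E (ts (2*n))" for n
      unfolding cn T_even(1)
    proof (rule even_interval_contraction[where c = "c Tstar" and T = Tstar])
      show "1 / 2 * ((norm (R w0))\<^sup>2 + (norm w1)\<^sup>2) \<le> c Tstar * integral {0..Tstar} (\<lambda>s. (norm (j (wt s)))\<^sup>2)"
        if "w0 \<in> V" "wave_solution V R w0 w1 w wt" for w0 w1 w wt by (rule obs[OF that])
    qed (rule c T_even(1)[symmetric] refl constants(1))+
    then show ?thesis
      using exponential_decay[OF period _ d _ d0 sup(3), of t] constants(1) t
      by (simp add: E_def less_imp_le)
  qed
  show ?thesis
  proof (intro exI conjI ballI allI impI)
    show "0 < 1 / d" using d0 by simp
    show "0 < - ln d / P" using d0 sup(3) P by (intro divide_pos_pos) simp_all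
  qed (rule decay)
qed

end
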